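(* Let $f:(\tau_1,\tau_2)\to(\sigma_1,\sigma_2)$ and $g:(\tau_3,\tau_4)\to(\sigma_3,\sigma_4)$ be invertible (bijective) functions such that $f$ and $g^{-1}$ are continuous. Assume $0\in(\tau_1,\tau_2)\cap(\tau_3,\tau_4)$, $f(0)=0$, $g(0)=0$, and that $f$ and $g$ are increasing. Let $a\in\mathbb{R}$, $c_1\in(\tau_1,\tau_2)$, $c_2\in(\tau_3,\tau_4)$, and assume $$F(c_1)+G(g(c_2))<\min\{G(\sigma_3),G(\sigma_4)\}.$$ Then there exists a unique local solution of the problem $$(g\circ x')'(t)+f(x(t))=0\ \text{ for a.e. } t,\qquad x(a)=c_1,\quad x'(a)=c_2 .$$ Furthermore, if $F(c_1)+G(g(c_2))<\min\{F(\tau_1),F(\tau_2)\}$, then this solution is defined on the whole real line and is periodic of smallest period $$T:=\int_{F_-^{-1}(k)}^{F_+^{-1}(k)}\left[\frac{1}{g^{-1}\left(G_+^{-1}(k-F(r))\right)}-\frac{1}{g^{-1}\left(G_-^{-1}(k-F(r))\right)}\right]\,dr,\qquad k:=G(g(c_2))+F(c_1).$$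
   Context: Here $\tau_i,\sigma_i\in[-\infty,\infty]$ for $i=1,\dots,4$, with $\tau_1<\tau_2$, $\sigma_1<\sigma_2$, $\tau_3<\tau_4$, $\sigma_3<\sigma_4$. "Increasing" means strictly increasing. Define $F(t):=\int_0^t f(s)\,ds$ for $t\in(\tau_1,\tau_2)$ and $G(t):=\int_0^t g^{-1}(s)\,ds$ for $t\in(\sigma_3,\sigma_4)$. The values $F(\tau_1),F(\tau_2),G(\sigma_3),G(\sigma_4)\in[0,+\infty]$ are the corresponding limits at the endpoints. $F_-$ and $F_+$ are the restrictions of $F$ to $(\tau_1,0]$ and $[0,\tau_2)$ respectively; $G_-$ and $G_+$ are the restrictions of $G$ to $(\sigma_3,0]$ and $[0,\sigma_4)$ respectively. Each of these four restrictions is injective, and $F_\pm^{-1}$, $G_\pm^{-1}$ denote their inverses. A solution of the problem on an open interval $I$ with $a\in I$ is a function $x\in C^1(I)$, with $x(t)\in(\tau_1,\tau_2)$ and $x'(t)\in(\tau_3,\tau_4)$ for $t\in I$, such that $g\circ x'$ is absolutely continuous (on compact subintervals of $I$), the differential equation holds for a.e. $t\in I$, and the initial conditions hold. "There exists a unique local solution" means that there is an open interval $I$ containing $a$ on which there is exactly one solution. *)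

theory Defs
  imports "HOL-Analysis.Analysis"
begin

text \<open>The interval integral is oriented, so this is the usual primitive also for \<open>t < 0\<close>.\<close>

definition primitive :: "(real \<Rightarrow> real) \<Rightarrow> real \<Rightarrow> real" where
  "primitive h t = (LBINT s=0..ereal t. h s)"

text \<open>Extended-real limits of a real function at a possibly infinite endpoint;
  the composition with \<open>real_of_ereal\<close> is the encoding used in
  \<open>HOL-Analysis.Interval_Integral\<close>.\<close>

definition limit_right :: "(real \<Rightarrow> real) \<Rightarrow> ereal \<Rightarrow> ereal" where
  "limit_right H \<tau> = Lim (at_right \<tau>) (ereal \<circ> H \<circ> real_of_ereal)"

definition limit_left :: "(real \<Rightarrow> real) \<Rightarrow> ereal \<Rightarrow> ereal" where
  "limit_left H \<tau> = Lim (at_left \<tau>) (ereal \<circ> H \<circ> real_of_ereal)"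

text \<open>Inverses of the restrictions of \<open>H\<close> to \<open>(\<alpha>, 0]\<close> and to \<open>[0, \<beta>)\<close>.\<close>

definition inv_minus :: "ereal \<Rightarrow> (real \<Rightarrow> real) \<Rightarrow> real \<Rightarrow> real" where
  "inv_minus \<alpha> H = the_inv_into {t. \<alpha> < ereal t \<and> t \<le> 0} H"

definition inv_plus :: "ereal \<Rightarrow> (real \<Rightarrow> real) \<Rightarrow> real \<Rightarrow> real" where
  "inv_plus \<beta> H = the_inv_into {t. 0 \<le> t \<and> ereal t < \<beta>} H"

text \<open>The usual epsilon-delta definition. The members of a \<open>division_of\<close> are finitely many
  nonempty compact intervals with disjoint interiors.\<close>

definition abs_continuous_on :: "real set \<Rightarrow> (real \<Rightarrow> real) \<Rightarrow> bool" where
  "abs_continuous_on S h \<longleftrightarrow>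
    (\<forall>\<epsilon>>0. \<exists>\<delta>>0. \<forall>\<D>. \<D> division_of \<Union>\<D> \<and> \<Union>\<D> \<subseteq> S \<and> (\<Sum>K\<in>\<D>. Sup K - Inf K) < \<delta>
        \<longrightarrow> (\<Sum>K\<in>\<D>. \<bar>h (Sup K) - h (Inf K)\<bar>) < \<epsilon>)"

text \<open>Only the values of \<open>x\<close> on the open interval \<open>I\<close> matter.\<close>

definition is_solution ::
  "(real \<Rightarrow> real) \<Rightarrow> (real \<Rightarrow> real) \<Rightarrow> ereal \<Rightarrow> ereal \<Rightarrow> ereal \<Rightarrow> ereal \<Rightarrow>
   real \<Rightarrow> real \<Rightarrow> real \<Rightarrow> real set \<Rightarrow> (real \<Rightarrow> real) \<Rightarrow> bool" where
  "is_solution f g \<tau>1 \<tau>2 \<tau>3 \<tau>4 a c1 c2 I x \<longleftrightarrow>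
     open I \<and> is_interval I \<and> a \<in> I \<and>
     x C1_differentiable_on I \<and>
     (\<forall>t\<in>I. x t \<in> einterval \<tau>1 \<tau>2 \<and> deriv x t \<in> einterval \<tau>3 \<tau>4) \<and>
     (\<forall>u v. {u..v} \<subseteq> I \<longrightarrow> abs_continuous_on {u..v} (g \<circ> deriv x)) \<and>
     (AE t in lborel. t \<in> I \<longrightarrow>
        (\<exists>d. ((g \<circ> deriv x) has_real_derivative d) (at t) \<and> d + f (x t) = 0)) \<and>
     x a = c1 \<and> deriv x a = c2"

text \<open>A constant function has every real as a period and hence no smallest positive one; its
  smallest period is \<open>0\<close> by convention. This convention is needed for the equilibrium solution
  \<open>x = 0\<close> (\<open>c1 = c2 = 0\<close>), where the integral for the period is taken over a single point.\<close>

definition smallest_period :: "(real \<Rightarrow> real) \<Rightarrow> real \<Rightarrow> bool" where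
  "smallest_period x T \<longleftrightarrow>
     (if x constant_on UNIV then T = 0
      else T > 0 \<and> (\<forall>t. x (t + T) = x t) \<and>
           (\<forall>p. 0 < p \<and> p < T \<longrightarrow> \<not> (\<forall>t. x (t + p) = x t)))"

end

theory Submission
  imports Defs
begin

text \<open>
  Put \<open>h = g\<^sup>-\<^sup>1\<close> and \<open>v = g \<circ> x'\<close>. The problem becomes the planar Hamiltonian system
  \<open>x' = h v\<close>, \<open>v' = - f x\<close> with energy \<open>F x + G v\<close>. Here \<open>f\<close> and \<open>h\<close> are continuous and strictly
  increasing and vanish at \<open>0\<close>, so \<open>F\<close> and \<open>G\<close> decrease to \<open>0\<close> on the left of \<open>0\<close> and increase on
  the right. A solution is only required to satisfy the equation almost everywhere, but absolute
  continuity of \<open>v\<close> together with continuity of \<open>f \<circ> x\<close> makes \<open>v\<close> continuously differentiable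
  (\<open>abs_continuous_ode_classical\<close>), so solutions and classical trajectories are the same thing
  (\<open>solution_imp_trajectory\<close>, \<open>trajectory_imp_solution\<close>).

  Uniqueness cannot come from a Lipschitz condition, as none is available; it comes from the energy
  (\<open>unique_trajectory\<close>). Energy zero means rest at the origin. At any other point one of the
  coordinates, say \<open>x\<close>, is strictly monotone in time. Its value determines the other coordinate
  through the energy, hence also the speed, so two trajectories through the point are time shifts of
  each other, and the shift is zero because they meet. The four cases \<open>v > 0\<close>, \<open>v < 0\<close>, \<open>x > 0\<close>,
  \<open>x < 0\<close> are permuted by the rotation \<open>(x, v) \<mapsto> (v, -x)\<close>, which maps the class of systems to
  itself.

  If the energy \<open>k > 0\<close> lies below all four limits of \<open>F\<close> and \<open>G\<close>, the level set is a closed curve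
  around the origin. Its upper half is the graph of \<open>V\<close> with \<open>G (V r) = k - F r\<close> over the interval
  between the two solutions of \<open>F r = k\<close>, and the time needed to travel along it is the integral of
  \<open>1 / h (V r)\<close> (\<open>half_orbit\<close>). The integrand blows up at both ends; the integral still converges,
  because \<open>V\<close> changes at the rate \<open>\<bar>f r\<bar> / h (V r)\<close> per unit of length and \<open>f\<close> stays
  away from \<open>0\<close> near the ends.
  Inverting the time of travel gives the motion on the upper half. The lower half is the upper half
  of a reflected system, and gluing the two and repeating them periodically gives a trajectory on the
  whole line (\<open>closed_orbit\<close>). It returns to its leftmost position only at multiples of the total
  travel time, which is therefore the smallest period.

  For local existence \<open>f\<close> is replaced, outside a compact interval around \<open>0\<close> and the initial
  position, by a function on the whole line whose primitive is unbounded on both sides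
  (\<open>extends_to_line\<close>); the closed orbit of the modified system solves the original problem for a
  short time (\<open>local_trajectory\<close>).
\<close>

section \<open>Calculus on intervals\<close>

text \<open>Gluing trajectories produces a continuous function whose derivative is known off the gluing
  points only. If the expected derivative is continuous, those points are harmless.\<close>

lemma derivative_across_finite_set:
  fixes x \<phi> :: "real \<Rightarrow> real"
  assumes S: "finite S" and x: "continuous_on {a..b} x" and \<phi>: "continuous_on {a..b} \<phi>"
    and der: "\<And>t. t \<in> {a<..<b} - S \<Longrightarrow> (x has_real_derivative \<phi> t) (at t)"
    and t: "t \<in> {a<..<b}"
  shows "(x has_real_derivative \<phi> t) (at t)"
proof -
  \<comment> \<open>The fundamental theorem of calculus tolerates finitely many exceptional points.\<close>
  have eq: "x s = x a + integral {a..s} \<phi>" if "s \<in> {a..b}" for s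
  proof -
    have "(\<phi> has_integral (x s - x a)) {a..s}"
    proof (rule fundamental_theorem_of_calculus_interior_strong[OF S])
      show "continuous_on {a..s} x" using x by (rule continuous_on_subset) (use that in auto)
    qed (use that der in \<open>auto simp: has_real_derivative_iff_has_vector_derivative[symmetric]\<close>)
    then show ?thesis by (simp add: integral_unique)
  qed
  have "((\<lambda>s. x a + integral {a..s} \<phi>) has_real_derivative \<phi> t) (at t within {a..b})"
    by (rule DERIV_cong) (rule derivative_eq_intros integral_has_real_derivative \<phi> refl | use t in simp)+
  then have "(x has_real_derivative \<phi> t) (at t within {a..b})"
    by (rule has_field_derivative_transform_within[OF _ zero_less_one]) (use t in \<open>simp_all add: eq[symmetric]\<close>)
  moreover have "at t within {a..b} = at t"
    by (rule at_within_interior) (use t in auto)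
  ultimately show ?thesis by simp
qed

text \<open>The inverse is continuous up to the endpoints although the derivative may vanish or blow up
  there. This is what happens at the turning points of an orbit.\<close>

lemma increasing_C1_inverse:
  fixes p p' :: "real \<Rightarrow> real"
  assumes ab: "a < b" and p: "continuous_on {a..b} p"
    and der: "\<And>t. t \<in> {a<..<b} \<Longrightarrow> (p has_real_derivative p' t) (at t)"
    and pos: "\<And>t. t \<in> {a<..<b} \<Longrightarrow> p' t > 0"
  obtains q where "continuous_on {p a..p b} q" "\<forall>t\<in>{a..b}. q (p t) = t"
    "\<forall>r\<in>{p a..p b}. q r \<in> {a..b} \<and> p (q r) = r"
    "\<forall>r\<in>{p a<..<p b}. q r \<in> {a<..<b} \<and> (q has_real_derivative 1 / p' (q r)) (at r)"
proof -
  have less: "p s < p t" if "s \<in> {a..b}" "t \<in> {a..b}" "s < t" for s t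
  proof (rule DERIV_pos_imp_increasing_open[where f = p and a = s and b = t])
    show "continuous_on {s..t} p" using p by (rule continuous_on_subset) (use that in auto)
    show "\<exists>y. (p has_real_derivative y) (at u) \<and> 0 < y" if "s < u" "u < t" for u
      using der[of u] pos[of u] that \<open>s \<in> _\<close> \<open>t \<in> _\<close> by auto
  qed fact
  have inj: "inj_on p {a..b}"
    by (rule linorder_inj_onI) (use less in \<open>auto simp: less_imp_neq\<close>)
  define q where "q = the_inv_into {a..b} p"
  have q1: "q (p t) = t" if "t \<in> {a..b}" for t
    unfolding q_def using inj that by (rule the_inv_into_f_f)
  have le: "p s \<le> p t" if "s \<in> {a..b}" "t \<in> {a..b}" "s \<le> t" for s t
    using less[of s t] that by (cases "s = t") auto
  have img: "p ` {a..b} = {p a..p b}"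
  proof
    show "p ` {a..b} \<subseteq> {p a..p b}" using le ab by auto
    show "{p a..p b} \<subseteq> p ` {a..b}"
      using IVT'[of p a _ b] ab p by (auto simp: image_iff) (metis atLeastAtMost_iff)
  qed
  have q2: "q r \<in> {a..b} \<and> p (q r) = r" if "r \<in> {p a..p b}" for r
    using that img q1 by (metis image_iff)
  have cont: "continuous_on {p a..p b} q"
    unfolding img[symmetric] by (rule continuous_on_inv) (use p q1 in auto)
  have "q r \<in> {a<..<b} \<and> (q has_real_derivative 1 / p' (q r)) (at r)" if r: "r \<in> {p a<..<p b}" for r
  proof
    have "q r \<in> {a..b}" "p (q r) = r" using q2[of r] r by auto
    then show qr: "q r \<in> {a<..<b}" using r by (auto simp: less_le)
    have "DERIV q r :> inverse (p' (q r))"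
    proof (rule DERIV_inverse_function[where a = "p a" and b = "p b"])
      show "isCont q r" using cont r by (simp add: continuous_on_interior)
    qed (use qr r der pos[of "q r"] q2 in auto)
    then show "(q has_real_derivative 1 / p' (q r)) (at r)" by (simp add: inverse_eq_divide)
  qed
  with that cont q1 q2 show thesis by blast
qed

lemma increasing_limits:
  fixes p :: "real \<Rightarrow> real"
  assumes ab: "a < b" and incr: "\<And>r s. a < r \<Longrightarrow> r \<le> s \<Longrightarrow> s < b \<Longrightarrow> p r \<le> p s"
    and bound: "\<And>r. a < r \<Longrightarrow> r < b \<Longrightarrow> l \<le> p r \<and> p r \<le> u"
  obtains p\<^sub>a p\<^sub>b where "(p \<longlongrightarrow> p\<^sub>a) (at_right a)" "(p \<longlongrightarrow> p\<^sub>b) (at_left b)"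
proof
  have "(p \<longlongrightarrow> Sup (p ` ({..<b} \<inter> {a<..<b}))) (at b within ({..<b} \<inter> {a<..<b}))"
    by (rule Lim_left_bound[where K = u]) (use incr bound in auto)
  moreover have "at b within {a<..<b} = at_left b"
    by (rule at_within_nhd[of _ "{a<..}"]) (use ab in auto)
  moreover have "{..<b} \<inter> {a<..<b} = {a<..<b}" by auto
  ultimately show "(p \<longlongrightarrow> Sup (p ` {a<..<b})) (at_left b)" by simp
  have "(p \<longlongrightarrow> Inf (p ` ({a<..} \<inter> {a<..<b}))) (at a within ({a<..} \<inter> {a<..<b}))"
    by (rule Lim_right_bound[where K = l]) (use incr bound in auto)
  moreover have "at a within {a<..<b} = at_right a"
    by (rule at_within_nhd[of _ "{..<b}"]) (use ab in auto)
  moreover have "{a<..} \<inter> {a<..<b} = {a<..<b}" by auto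
  ultimately show "(p \<longlongrightarrow> Inf (p ` {a<..<b})) (at_right a)" by simp
qed

lemma continuous_on_concat:
  fixes p q :: "real \<Rightarrow> real"
  assumes "continuous_on {a..b} p" "continuous_on {b..c} q" "p b = q b" "a \<le> b" "b \<le> c"
  shows "continuous_on {a..c} (\<lambda>t. if t \<le> b then p t else q t)"
proof -
  have "{a..c} = {a..b} \<union> {b..c}" using assms by auto
  then show ?thesis
    using assms by (auto intro!: continuous_on_cases)
qed

lemma Lipschitz_of_continuous_derivative:
  fixes \<phi> v :: "real \<Rightarrow> real"
  assumes \<phi>: "continuous_on {u..w} \<phi>"
    and der: "\<And>t. t \<in> {u..w} \<Longrightarrow> (v has_real_derivative \<phi> t) (at t within {u..w})"
  obtains C where "\<forall>s\<in>{u..w}. \<forall>t\<in>{u..w}. \<bar>v s - v t\<bar> \<le> C * \<bar>s - t\<bar>"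
proof -
  have "bounded (\<phi> ` {u..w})"
    using \<phi> by (intro compact_imp_bounded compact_continuous_image) auto
  then obtain C where "\<forall>t\<in>{u..w}. \<bar>\<phi> t\<bar> \<le> C" unfolding bounded_iff by auto
  then have "\<forall>s\<in>{u..w}. \<forall>t\<in>{u..w}. \<bar>v s - v t\<bar> \<le> C * \<bar>s - t\<bar>"
    using field_differentiable_bound[of "{u..w}" v \<phi> C] der by (auto simp: real_norm_def)
  then show thesis by (rule that)
qed

section \<open>Absolute continuity\<close>

lemma abs_continuous_on_subset:
  "abs_continuous_on S h \<Longrightarrow> S' \<subseteq> S \<Longrightarrow> abs_continuous_on S' h"
  unfolding abs_continuous_on_def by (meson order_trans)

lemma division_of_realE:
  fixes K :: "real set"
  assumes "\<D> division_of S" "K \<in> \<D>"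
  obtains c d where "K = {c..d}" "c \<le> d" "Inf K = c" "Sup K = d"
  using division_ofD(3,4)[OF assms] by (metis atLeastatMost_empty_iff cInf_atLeastAtMost cSup_atLeastAtMost interval_cbox not_le)

lemma abs_continuous_on_Lipschitz:
  assumes lip: "\<And>s t. s \<in> S \<Longrightarrow> t \<in> S \<Longrightarrow> \<bar>h s - h t\<bar> \<le> C * \<bar>s - t\<bar>"
  shows "abs_continuous_on S h"
  unfolding abs_continuous_on_def
proof (intro allI impI)
  define C' where "C' = max C 1"
  fix \<epsilon> :: real assume "\<epsilon> > 0"
  show "\<exists>\<delta>>0. \<forall>\<D>. \<D> division_of \<Union>\<D> \<and> \<Union>\<D> \<subseteq> S \<and> (\<Sum>K\<in>\<D>. Sup K - Inf K) < \<delta>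
        \<longrightarrow> (\<Sum>K\<in>\<D>. \<bar>h (Sup K) - h (Inf K)\<bar>) < \<epsilon>"
  proof (intro exI[of _ "\<epsilon> / C'"] conjI allI impI; (elim conjE)?)
    fix \<D> assume \<D>: "\<D> division_of \<Union>\<D>" "\<Union>\<D> \<subseteq> S" "(\<Sum>K\<in>\<D>. Sup K - Inf K) < \<epsilon> / C'"
    have "\<bar>h (Sup K) - h (Inf K)\<bar> \<le> C' * (Sup K - Inf K)" if K: "K \<in> \<D>" for K
    proof -
      obtain c d where cd: "K = {c..d}" "c \<le> d" "Inf K = c" "Sup K = d"
        using division_of_realE[OF \<D>(1) K] .
      have "c \<in> S" "d \<in> S" using cd(1,2) subset_trans[OF Union_upper[OF K] \<D>(2)] by auto
      have "\<bar>h d - h c\<bar> \<le> C * \<bar>d - c\<bar>" by (rule lip) fact+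
      also have "\<dots> \<le> C' * (d - c)" unfolding C'_def using cd by (intro mult_mono) auto
      finally show ?thesis using cd by simp
    qed
    then have "(\<Sum>K\<in>\<D>. \<bar>h (Sup K) - h (Inf K)\<bar>) \<le> C' * (\<Sum>K\<in>\<D>. Sup K - Inf K)"
      unfolding sum_distrib_left by (rule sum_mono)
    also have "\<dots> < \<epsilon>" using \<D>(3) by (simp add: C'_def field_simps)
    finally show "(\<Sum>K\<in>\<D>. \<bar>h (Sup K) - h (Inf K)\<bar>) < \<epsilon>" .
  qed (use \<open>\<epsilon> > 0\<close> in \<open>auto simp: C'_def\<close>)
qed

lemma abs_continuous_on_diff:
  assumes "abs_continuous_on S h" "abs_continuous_on S k"
  shows "abs_continuous_on S (\<lambda>t. h t - k t)"
  unfolding abs_continuous_on_def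
proof (intro allI impI)
  fix \<epsilon> :: real assume "\<epsilon> > 0"
  then have e: "\<epsilon> / 2 > 0" by simp
  from assms(1)[unfolded abs_continuous_on_def, rule_format, OF e] obtain d1 where d1: "d1 > 0"
    "\<And>\<D>. \<D> division_of \<Union>\<D> \<and> \<Union>\<D> \<subseteq> S \<and> (\<Sum>K\<in>\<D>. Sup K - Inf K) < d1
        \<Longrightarrow> (\<Sum>K\<in>\<D>. \<bar>h (Sup K) - h (Inf K)\<bar>) < \<epsilon> / 2" by auto
  from assms(2)[unfolded abs_continuous_on_def, rule_format, OF e] obtain d2 where d2: "d2 > 0"
    "\<And>\<D>. \<D> division_of \<Union>\<D> \<and> \<Union>\<D> \<subseteq> S \<and> (\<Sum>K\<in>\<D>. Sup K - Inf K) < d2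
        \<Longrightarrow> (\<Sum>K\<in>\<D>. \<bar>k (Sup K) - k (Inf K)\<bar>) < \<epsilon> / 2" by auto
  show "\<exists>\<delta>>0. \<forall>\<D>. \<D> division_of \<Union>\<D> \<and> \<Union>\<D> \<subseteq> S \<and> (\<Sum>K\<in>\<D>. Sup K - Inf K) < \<delta>
        \<longrightarrow> (\<Sum>K\<in>\<D>. \<bar>(h (Sup K) - k (Sup K)) - (h (Inf K) - k (Inf K))\<bar>) < \<epsilon>"
  proof (intro exI[of _ "min d1 d2"] conjI allI impI)
    fix \<D> assume \<D>: "\<D> division_of \<Union>\<D> \<and> \<Union>\<D> \<subseteq> S \<and> (\<Sum>K\<in>\<D>. Sup K - Inf K) < min d1 d2"
    have "(\<Sum>K\<in>\<D>. \<bar>(h (Sup K) - k (Sup K)) - (h (Inf K) - k (Inf K))\<bar>)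
        \<le> (\<Sum>K\<in>\<D>. \<bar>h (Sup K) - h (Inf K)\<bar>) + (\<Sum>K\<in>\<D>. \<bar>k (Sup K) - k (Inf K)\<bar>)"
      unfolding sum.distrib[symmetric] by (rule sum_mono) linarith
    also have "\<dots> < \<epsilon> / 2 + \<epsilon> / 2"
      using d1(2)[of \<D>] d2(2)[of \<D>] \<D> by (intro add_strict_mono) auto
    finally show "(\<Sum>K\<in>\<D>. \<bar>(h (Sup K) - k (Sup K)) - (h (Inf K) - k (Inf K))\<bar>) < \<epsilon>" by simp
  qed (use d1 d2 in auto)
qed

text \<open>A Henstock sum: cut \<open>[a, b]\<close> into finely tagged intervals. Those tagged in \<open>N\<close> have small total
  length and contribute little by absolute continuity; on each of the others \<open>h\<close> changes by at most
  \<open>e\<close> times the length, as its derivative at the tag is \<open>0\<close>.\<close>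

lemma abs_continuous_on_zero_derivative:
  fixes h :: "real \<Rightarrow> real"
  assumes ab: "a \<le> b" and ac: "abs_continuous_on {a..b} h" and N: "N \<in> null_sets lebesgue"
    and der: "\<And>t. t \<in> {a..b} - N \<Longrightarrow> (h has_real_derivative 0) (at t)"
  shows "h b = h a"
proof -
  have "\<bar>h b - h a\<bar> \<le> e * (b - a + 1)" if e: "e > 0" for e
  proof -
    obtain \<delta> where \<delta>: "\<delta> > 0"
      "\<And>\<D>. \<D> division_of \<Union>\<D> \<and> \<Union>\<D> \<subseteq> {a..b} \<and> (\<Sum>K\<in>\<D>. Sup K - Inf K) < \<delta>
        \<Longrightarrow> (\<Sum>K\<in>\<D>. \<bar>h (Sup K) - h (Inf K)\<bar>) < e"
      using ac e unfolding abs_continuous_on_def by meson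
    obtain U where U: "open U" "N \<subseteq> U" "U - N \<in> lmeasurable" "emeasure lebesgue (U - N) < ennreal \<delta>"
      using sets_lebesgue_outer_open[of N \<delta>] N \<delta> by auto
    have Um: "U \<in> lmeasurable" "measure lebesgue U < \<delta>"
    proof -
      have UN: "U = (U - N) \<union> N" using U by auto
      have "emeasure lebesgue U = emeasure lebesgue (U - N)"
        by (subst UN, rule emeasure_Un_null_set) (use U N in auto)
      then have "emeasure lebesgue U < ennreal \<delta>" using U by simp
      moreover have "U \<in> sets lebesgue" using U(1) by auto
      ultimately show Um: "U \<in> lmeasurable"
        by (intro fmeasurableI) (auto intro: order_less_trans[OF _ ennreal_less_top])
      show "measure lebesgue U < \<delta>"
        using \<open>emeasure lebesgue U < ennreal \<delta>\<close> by (simp only: emeasure_eq_measure2[OF Um] ennreal_less_iff measure_nonneg)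
    qed
    have "\<exists>r>0. \<forall>s. \<bar>s - t\<bar> < r \<longrightarrow> \<bar>h s - h t\<bar> \<le> e * \<bar>s - t\<bar>" if "t \<in> {a..b} - N" for t
    proof -
      have "(h has_derivative (\<lambda>_. 0)) (at t)"
        using der[OF that] by (simp add: has_field_derivative_def lambda_zero)
      then show ?thesis unfolding has_derivative_at_alt using e by (auto simp: real_norm_def)
    qed
    then obtain r where r: "\<And>t. t \<in> {a..b} - N \<Longrightarrow> r t > 0"
      "\<And>t s. t \<in> {a..b} - N \<Longrightarrow> \<bar>s - t\<bar> < r t \<Longrightarrow> \<bar>h s - h t\<bar> \<le> e * \<bar>s - t\<bar>" by metis
    \<comment> \<open>Intervals tagged in the null set stay inside a set of measure below \<open>\<delta>\<close>, where absolute
      continuity applies; the others are short enough for the vanishing derivative to be felt.\<close>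
    define \<gamma> where "\<gamma> t = (if t \<in> N then U else if t \<in> {a..b} then ball t (r t) else ball t 1)" for t
    have "gauge \<gamma>" unfolding gauge_def \<gamma>_def using U r by auto
    then obtain p where p: "p tagged_division_of {a..b}" "\<gamma> fine p"
      by (rule fine_division_exists_real)
    define p1 where "p1 = {(t, K) \<in> p. t \<in> N}"
    define p2 where "p2 = {(t, K) \<in> p. t \<notin> N}"
    have fin: "finite p" using p(1) by blast
    have p12: "p = p1 \<union> p2" "p1 \<inter> p2 = {}" by (auto simp: p1_def p2_def)
    have fin12: "finite p1" "finite p2" using fin p12 by auto
    let ?d = "\<lambda>(t, K). h (Sup K) - h (Inf K)"
    let ?D = "\<lambda>K. \<bar>h (Sup K) - h (Inf K)\<bar>"
    have mem: "\<exists>c d. K = {c..d} \<and> c \<le> d \<and> Inf K = c \<and> Sup K = d \<and> t \<in> {c..d} \<and> {c..d} \<subseteq> {a..b}"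
      if "(t, K) \<in> p" for t K
      using tagged_division_ofD(2-4)[OF p(1) that] by fastforce
    have tp1: "p1 tagged_partial_division_of {a..b}"
      using p(1) unfolding tagged_division_of_def
      by (auto elim!: tagged_partial_division_subset simp: p1_def)
    then have div: "snd ` p1 division_of \<Union>(snd ` p1)"
      by (rule partial_division_of_tagged_division)
    have sub1: "\<Union>(snd ` p1) \<subseteq> {a..b}"
      using mem by (fastforce simp: p1_def)
    have subU: "\<Union>(snd ` p1) \<subseteq> U"
      using p(2) by (fastforce simp: p1_def fine_def \<gamma>_def)
    have content: "Sup K - Inf K = measure lebesgue K" if "K \<in> snd ` p1" for K
    proof -
      obtain t where "(t, K) \<in> p" using \<open>K \<in> snd ` p1\<close> by (auto simp: p1_def)
      then obtain c d where "K = {c..d}" "c \<le> d" using mem by blast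
      then show ?thesis by (simp add: measure_completion)
    qed
    have "(\<Sum>K\<in>snd ` p1. Sup K - Inf K) = (\<Sum>K\<in>snd ` p1. measure lebesgue K)"
      using content by (rule sum.cong[OF refl])
    also have "\<dots> = measure lebesgue (\<Union>(snd ` p1))"
      using content_division[OF div] by simp
    also have "\<dots> \<le> measure lebesgue U"
      by (rule measure_mono_fmeasurable) (use subU Um lmeasurable_division[OF div] in auto)
    finally have "(\<Sum>K\<in>snd ` p1. ?D K) < e"
      using \<delta>(2)[of "snd ` p1"] div sub1 Um by auto
    moreover have "(\<Sum>(t, K)\<in>p1. ?D K) = (\<Sum>K\<in>snd ` p1. ?D K)"
    proof -
      have ne: "K \<noteq> {}" if "(t, K) \<in> p1" for t K
        using that mem[of t K] by (auto simp: p1_def)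
      let ?D' = "\<lambda>K. if K = {} then 0 else ?D K"
      have "(\<Sum>(t, K)\<in>p1. ?D' K) = (\<Sum>K\<in>snd ` p1. ?D' K)"
        by (rule sum.over_tagged_division_lemma[OF tagged_partial_division_of_Union_self[OF tp1]])
          (auto simp: not_less)
      moreover have "(\<Sum>(t, K)\<in>p1. ?D' K) = (\<Sum>(t, K)\<in>p1. ?D K)"
        by (rule sum.cong) (auto dest: ne)
      moreover have "(\<Sum>K\<in>snd ` p1. ?D' K) = (\<Sum>K\<in>snd ` p1. ?D K)"
        by (rule sum.cong) (auto dest: ne)
      ultimately show ?thesis by simp
    qed
    ultimately have s1: "(\<Sum>(t, K)\<in>p1. ?D K) < e" by simp
    have "\<bar>h (Sup K) - h (Inf K)\<bar> \<le> e * measure lborel K" if "(t, K) \<in> p2" for t K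
    proof -
      have tK: "(t, K) \<in> p" "t \<notin> N" using that by (auto simp: p2_def)
      obtain c d where cd: "K = {c..d}" "c \<le> d" "Inf K = c" "Sup K = d" "t \<in> {c..d}" "{c..d} \<subseteq> {a..b}"
        using mem[OF tK(1)] by blast
      have t: "t \<in> {a..b} - N" using cd tK by auto
      have "{c..d} \<subseteq> ball t (r t)"
        using fineD[OF p(2) tK(1)] t cd(1) by (simp add: \<gamma>_def)
      then have "\<bar>c - t\<bar> < r t" "\<bar>d - t\<bar> < r t" using cd(2) by (auto simp: subset_iff dist_real_def)
      from this[THEN r(2)[OF t]] have "\<bar>h d - h c\<bar> \<le> e * \<bar>c - t\<bar> + e * \<bar>d - t\<bar>" by linarith
      also have "\<dots> = e * (d - c)" using cd by (simp add: algebra_simps)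
      finally show ?thesis using cd by simp
    qed
    then have "(\<Sum>(t, K)\<in>p2. ?D K) \<le> (\<Sum>(t, K)\<in>p2. e * measure lborel K)"
      by (intro sum_mono) auto
    also have "\<dots> \<le> (\<Sum>(t, K)\<in>p. e * measure lborel K)"
      using e p12 fin by (intro sum_mono2) auto
    also have "\<dots> = e * (b - a)"
      using additive_content_tagged_division[of p a b] p(1) ab
      by (simp add: sum_distrib_left[symmetric] case_prod_unfold)
    finally have s2: "(\<Sum>(t, K)\<in>p2. ?D K) \<le> e * (b - a)" .
    have "h b - h a = (\<Sum>(t, K)\<in>p. h (Sup K) - h (Inf K))"
      by (rule additive_tagged_division_1[OF ab p(1), symmetric])
    also have "\<bar>\<dots>\<bar> \<le> (\<Sum>(t, K)\<in>p. ?D K)"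
      by (simp add: case_prod_unfold sum_abs)
    also have "\<dots> = (\<Sum>(t, K)\<in>p1. ?D K) + (\<Sum>(t, K)\<in>p2. ?D K)"
      unfolding p12(1) by (rule sum.union_disjoint) (use fin12 p12 in auto)
    also have "\<dots> \<le> e * (b - a + 1)" using s1 s2 by (simp add: algebra_simps)
    finally show ?thesis .
  qed
  note bound = this
  show ?thesis
  proof (rule ccontr)
    assume "h b \<noteq> h a"
    then have pos: "\<bar>h b - h a\<bar> > 0" by simp
    have "\<bar>h b - h a\<bar> \<le> (\<bar>h b - h a\<bar> / (2 * (b - a + 1))) * (b - a + 1)"
      by (rule bound) (use pos ab in auto)
    also have "\<dots> = \<bar>h b - h a\<bar> / 2" using ab by (simp add: field_simps)
    finally show False using pos by simp
  qed
qed

text \<open>An absolutely continuous function with continuous almost-everywhere derivative differs from the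
  integral of that derivative by a constant.\<close>

lemma abs_continuous_ode_classical:
  fixes \<phi> v :: "real \<Rightarrow> real"
  assumes I: "open I" "is_interval I" and \<phi>: "continuous_on I \<phi>"
    and ac: "\<forall>u w. {u..w} \<subseteq> I \<longrightarrow> abs_continuous_on {u..w} v"
    and ae: "AE t in lborel. t \<in> I \<longrightarrow> (v has_real_derivative \<phi> t) (at t)"
    and t: "t \<in> I"
  shows "(v has_real_derivative \<phi> t) (at t)"
proof -
  obtain e where e: "0 < e" "cball t e \<subseteq> I" using I(1) t unfolding open_contains_cball by blast
  define a where "a = t - e"
  define b where "b = t + e"
  have ab: "{a..b} \<subseteq> I" "a < t" "t < b" using e by (auto simp: a_def b_def cball_eq_atLeastAtMost)
  have \<phi>': "continuous_on {a..b} \<phi>" using \<phi> ab(1) by (rule continuous_on_subset)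
  define \<Phi> where "\<Phi> s = integral {a..s} \<phi>" for s
  have \<Phi>: "(\<Phi> has_real_derivative \<phi> s) (at s within {a..b})" if "s \<in> {a..b}" for s
    unfolding \<Phi>_def by (rule integral_has_real_derivative[OF \<phi>' that])
  obtain C where C: "\<forall>s\<in>{a..b}. \<forall>t\<in>{a..b}. \<bar>\<Phi> s - \<Phi> t\<bar> \<le> C * \<bar>s - t\<bar>"
    by (rule Lipschitz_of_continuous_derivative[OF \<phi>' \<Phi>])
  obtain N where N: "\<And>s. s \<in> space lborel - N \<Longrightarrow> s \<in> I \<longrightarrow> (v has_real_derivative \<phi> s) (at s)"
    "N \<in> null_sets lborel"
    using AE_E3[OF ae] by blast
  \<comment> \<open>At the two endpoints \<open>\<Phi>\<close> need not have a two-sided derivative.\<close>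
  have "{a, b} \<in> null_sets lborel" by (intro countable_imp_null_set_lborel) auto
  then have null: "N \<union> {a, b} \<in> null_sets lebesgue"
    using null_sets_completionI[OF null_sets.Un[OF N(2)]] by blast
  have eq: "v s - \<Phi> s = v a - \<Phi> a" if s: "s \<in> {a..b}" for s
  proof (rule abs_continuous_on_zero_derivative[OF _ _ null, where h = "\<lambda>s. v s - \<Phi> s"])
    show "a \<le> s" using s by simp
    have "abs_continuous_on {a..b} v" using ac ab(1) by blast
    moreover have "abs_continuous_on {a..b} \<Phi>" using C by (intro abs_continuous_on_Lipschitz) blast
    ultimately have "abs_continuous_on {a..b} (\<lambda>s. v s - \<Phi> s)" by (rule abs_continuous_on_diff)
    then show "abs_continuous_on {a..s} (\<lambda>s. v s - \<Phi> s)"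
      by (rule abs_continuous_on_subset) (use s in auto)
    fix r assume r: "r \<in> {a..s} - (N \<union> {a, b})"
    then have rab: "r \<in> {a..b}" using s by auto
    have "at r within {a..b} = at r" by (rule at_within_interior) (use r s in auto)
    with \<Phi>[OF rab] have "(\<Phi> has_real_derivative \<phi> r) (at r)" by simp
    moreover have "(v has_real_derivative \<phi> r) (at r)" using N(1)[of r] r rab ab(1) by auto
    ultimately show "((\<lambda>s. v s - \<Phi> s) has_real_derivative 0) (at r)"
      using DERIV_diff by fastforce
  qed
  have "at t within {a..b} = at t" by (rule at_within_interior) (use ab in auto)
  then have "(\<Phi> has_real_derivative \<phi> t) (at t)" using \<Phi>[of t] ab by simp
  then have "((\<lambda>s. \<Phi> s + (v a - \<Phi> a)) has_real_derivative \<phi> t) (at t)"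
    by (auto intro!: derivative_eq_intros)
  then show ?thesis
    by (rule has_field_derivative_transform_within_open[of _ _ _ "{a<..<b}"])
      (use ab eq in \<open>auto simp: algebra_simps\<close>)
qed

section \<open>Periodic continuation\<close>

definition periodisation :: "real \<Rightarrow> (real \<Rightarrow> real) \<Rightarrow> real \<Rightarrow> real" where
  "periodisation T p t = p (t - T * of_int \<lfloor>t / T\<rfloor>)"

lemma floor_divide_bounds:
  fixes t T :: real
  assumes "T > 0"
  shows "T * of_int \<lfloor>t / T\<rfloor> \<le> t" "t < T * of_int \<lfloor>t / T\<rfloor> + T"
proof -
  have "T * of_int \<lfloor>t / T\<rfloor> \<le> T * (t / T)" "T * (t / T) < T * (of_int \<lfloor>t / T\<rfloor> + 1)"
    by (intro mult_left_mono mult_strict_left_mono; use assms in \<open>simp add: floor_correct\<close>)+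
  then show "T * of_int \<lfloor>t / T\<rfloor> \<le> t" "t < T * of_int \<lfloor>t / T\<rfloor> + T"
    using assms by (simp_all add: distrib_left)
qed

text \<open>Thanks to \<open>p 0 = p T\<close>, the right endpoint of each period may be included.\<close>

lemma periodisation_shift:
  assumes T: "T > 0" and p: "p 0 = p T" and t: "t \<in> {T * of_int n..T * of_int n + T}"
  shows "periodisation T p t = p (t - T * of_int n)"
proof (cases "t = T * of_int n + T")
  case True
  then have "t / T = of_int (n + 1)" using T by (simp add: field_simps)
  then show ?thesis using True p by (simp add: periodisation_def algebra_simps)
next
  case False
  then have "\<lfloor>t / T\<rfloor> = n" using T t by (intro floor_unique) (auto simp: field_simps)
  then show ?thesis by (simp add: periodisation_def)
qed

lemma periodisation_periodic:
  assumes "T > 0" shows "periodisation T p (t + T) = periodisation T p t"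
proof -
  have "(t + T) / T = t / T + 1" using assms by (simp add: field_simps)
  then show ?thesis by (simp add: periodisation_def algebra_simps)
qed

text \<open>The interval spans two periods: every real number lies in the interior of such an interval.\<close>

lemma continuous_on_periodisation:
  assumes T: "T > 0" and p: "p 0 = p T" "continuous_on {0..T} p"
  shows "continuous_on {T * of_int n - T..T * of_int n + T} (periodisation T p)"
proof -
  have *: "continuous_on {T * of_int m..T * of_int m + T} (periodisation T p)" for m
  proof -
    have "continuous_on {T * of_int m..T * of_int m + T} (\<lambda>t. p (t - T * of_int m))"
      by (rule continuous_on_compose2[OF p(2)]) (auto intro!: continuous_intros)
    then show ?thesis
      by (rule continuous_on_eq) (simp add: periodisation_shift[OF T p(1)])
  qed
  have "{T * of_int n - T..T * of_int n + T} =
      {T * of_int (n - 1)..T * of_int (n - 1) + T} \<union> {T * of_int n..T * of_int n + T}"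
    using T by (auto simp: algebra_simps)
  then show ?thesis using *[of "n - 1"] *[of n] by (metis continuous_on_closed_Un closed_atLeastAtMost)
qed

text \<open>The right-hand side \<open>h \<circ> q\<close> is continuous and matches at the ends of the period, so the
  continuation solves the equation at the gluing points as well.\<close>

lemma periodisation_derivative:
  assumes T: "T > 0" and p: "p 0 = p T" "q 0 = q T"
    and cont: "continuous_on {0..T} p" "continuous_on {0..T} q"
    and h: "continuous_on (q ` {0..T}) h"
    and S: "finite S"
    and der: "\<And>t. t \<in> {0<..<T} - S \<Longrightarrow> (p has_real_derivative h (q t)) (at t)"
  shows "(periodisation T p has_real_derivative h (periodisation T q t)) (at t)"
proof -
  define n where "n = \<lfloor>t / T\<rfloor>"
  \<comment> \<open>The window of length \<open>2 T\<close> around the period containing \<open>t\<close> has \<open>t\<close> in its interior even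
    when \<open>t\<close> is a multiple of \<open>T\<close>.\<close>
  define S' where "S' = (\<lambda>(m, s). T * of_int m + s) ` ({n - 1..n + 1} \<times> insert 0 S)"
  let ?I = "{T * of_int n - T..T * of_int n + T}"
  have n: "T * of_int n \<le> t" "t < T * of_int n + T"
    using floor_divide_bounds[OF T, of t] unfolding n_def by auto
  have hq: "continuous_on ?I (\<lambda>t. h (periodisation T q t))"
  proof (rule continuous_on_compose2[OF h continuous_on_periodisation[OF T p(2) cont(2)]])
    show "periodisation T q ` ?I \<subseteq> q ` {0..T}"
    proof clarify
      fix s
      have "s - T * of_int \<lfloor>s / T\<rfloor> \<in> {0..T}"
        using floor_divide_bounds[OF T, of s] by auto
      then show "periodisation T q s \<in> q ` {0..T}" unfolding periodisation_def by blast
    qed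
  qed
  show ?thesis
  proof (rule derivative_across_finite_set[of S', OF _ continuous_on_periodisation[OF T p(1) cont(1)] hq])
    show "finite S'" using S by (auto simp: S'_def)
    show "t \<in> {T * of_int n - T<..<T * of_int n + T}" using n T by auto
    fix s assume s: "s \<in> {T * of_int n - T<..<T * of_int n + T} - S'"
    define m where "m = \<lfloor>s / T\<rfloor>"
    have m: "T * of_int m \<le> s" "s < T * of_int m + T"
      using floor_divide_bounds[OF T, of s] unfolding m_def by auto
    have "T * of_int m < T * of_int (n + 1)" "T * of_int (n - 1) < T * of_int (m + 1)"
      using m s by (auto simp: algebra_simps)
    then have mn: "m \<in> {n - 1..n + 1}" using T unfolding mult_less_cancel_left_pos[OF T] of_int_less_iff by auto
    then have "T * of_int m + s' \<in> S'" if "s' \<in> insert 0 S" for s'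
      unfolding S'_def using that by force
    then have ns: "s - T * of_int m \<notin> insert 0 S" using s by (metis DiffD2 add.commute diff_add_cancel)
    then have in0: "s - T * of_int m \<in> {0<..<T} - S" using m by auto
    have "((\<lambda>u. p (u - T * of_int m)) has_real_derivative h (q (s - T * of_int m))) (at s)"
      using der[OF in0] by (simp add: DERIV_shift[of p _ s "- (T * of_int m)", simplified])
    then have "(periodisation T p has_real_derivative h (q (s - T * of_int m))) (at s)"
    proof (rule has_field_derivative_transform_within_open[of _ _ _ "{T * of_int m<..<T * of_int m + T}"])
      show "p (u - T * of_int m) = periodisation T p u" if "u \<in> {T * of_int m<..<T * of_int m + T}" for u
        using periodisation_shift[OF T p(1), of u m] that by auto
    qed (use in0 in auto)
    then show "(periodisation T p has_real_derivative h (periodisation T q s)) (at s)"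
      using periodisation_shift[OF T p(2), of s m] m by auto
  qed
qed

section \<open>Potentials with a minimum at the origin\<close>

lemma limit_left_mono:
  assumes "0 < \<tau>" and mono: "\<And>s t. 0 \<le> s \<Longrightarrow> s \<le> t \<Longrightarrow> ereal t < \<tau> \<Longrightarrow> H s \<le> H t"
  shows "limit_left H \<tau> = (SUP t\<in>{t. 0 \<le> t \<and> ereal t < \<tau>}. ereal (H t))"
  unfolding limit_left_def
proof (rule tendsto_Lim)
  let ?L = "SUP t\<in>{t. 0 \<le> t \<and> ereal t < \<tau>}. ereal (H t)"
  show "\<not> trivial_limit (at_left \<tau>)" using assms(1) by (auto simp: trivial_limit_def eventually_at_left[OF assms(1)] dest: dense)
  have pos: "eventually (\<lambda>s. 0 < s) (at_left \<tau>)" "eventually (\<lambda>s. s < \<tau>) (at_left \<tau>)"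
    using assms(1) by (auto simp: eventually_at_left[OF assms(1)])
  show "((ereal \<circ> H \<circ> real_of_ereal) \<longlongrightarrow> ?L) (at_left \<tau>)"
  proof (rule order_tendstoI)
    fix l assume "l < ?L"
    then obtain t where t: "0 \<le> t" "ereal t < \<tau>" "l < ereal (H t)" by (auto simp: less_SUP_iff)
    have "eventually (\<lambda>s. ereal t < s) (at_left \<tau>)"
      using t by (auto simp: eventually_at_left[OF assms(1)])
    with pos(2) show "eventually (\<lambda>s. l < (ereal \<circ> H \<circ> real_of_ereal) s) (at_left \<tau>)"
    proof eventually_elim
      case (elim s)
      then obtain s' where "s = ereal s'" by (cases s) auto
      then show ?case using elim mono[of t s'] t by (auto intro: less_le_trans)
    qed
  next
    fix u assume u: "?L < u"
    from pos show "eventually (\<lambda>s. (ereal \<circ> H \<circ> real_of_ereal) s < u) (at_left \<tau>)"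
    proof eventually_elim
      case (elim s)
      then obtain s' where s': "s = ereal s'" by (cases s) auto
      then have "ereal (H s') \<le> ?L" using elim by (intro SUP_upper) auto
      then show ?case using u s' by auto
    qed
  qed
qed

lemma limit_right_mono:
  assumes "\<tau> < 0" and mono: "\<And>s t. t \<le> 0 \<Longrightarrow> s \<le> t \<Longrightarrow> \<tau> < ereal s \<Longrightarrow> H t \<le> H s"
  shows "limit_right H \<tau> = (SUP t\<in>{t. \<tau> < ereal t \<and> t \<le> 0}. ereal (H t))"
  unfolding limit_right_def
proof (rule tendsto_Lim)
  let ?L = "SUP t\<in>{t. \<tau> < ereal t \<and> t \<le> 0}. ereal (H t)"
  show "\<not> trivial_limit (at_right \<tau>)" using assms(1) by (auto simp: trivial_limit_def eventually_at_right[OF assms(1)] dest: dense)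
  have pos: "eventually (\<lambda>s. s < 0) (at_right \<tau>)" "eventually (\<lambda>s. \<tau> < s) (at_right \<tau>)"
    using assms(1) by (auto simp: eventually_at_right[OF assms(1)])
  show "((ereal \<circ> H \<circ> real_of_ereal) \<longlongrightarrow> ?L) (at_right \<tau>)"
  proof (rule order_tendstoI)
    fix l assume "l < ?L"
    then obtain t where t: "t \<le> 0" "\<tau> < ereal t" "l < ereal (H t)" by (auto simp: less_SUP_iff)
    have "eventually (\<lambda>s. s < ereal t) (at_right \<tau>)"
      using t by (auto simp: eventually_at_right[OF assms(1)])
    with pos(2) show "eventually (\<lambda>s. l < (ereal \<circ> H \<circ> real_of_ereal) s) (at_right \<tau>)"
    proof eventually_elim
      case (elim s)
      then obtain s' where "s = ereal s'" by (cases s) auto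
      then show ?case using elim mono[of t s'] t by (auto intro: less_le_trans)
    qed
  next
    fix u assume u: "?L < u"
    from pos show "eventually (\<lambda>s. (ereal \<circ> H \<circ> real_of_ereal) s < u) (at_right \<tau>)"
    proof eventually_elim
      case (elim s)
      then obtain s' where s': "s = ereal s'" by (cases s) auto
      then have "ereal (H s') \<le> ?L" using elim by (intro SUP_upper) auto
      then show ?case using u s' by auto
    qed
  qed
qed

text \<open>Both \<open>F\<close> (with derivative \<open>f\<close>) and \<open>G\<close> (with derivative the inverse of \<open>g\<close>) are potentials in
  this sense. The notion is invariant under the reflection of the line, which carries every fact about
  the positive half to the negative half.\<close>

locale potential =
  fixes S :: "real set" and p P :: "real \<Rightarrow> real"
  assumes open_S: "open S" and interval_S: "is_interval S" and zero_S: "0 \<in> S"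
    and cont: "continuous_on S p" and mono: "strict_mono_on S p" and p_0: "p 0 = 0"
    and P_0: "P 0 = 0" and der: "\<And>s. s \<in> S \<Longrightarrow> (P has_real_derivative p s) (at s)"

begin

lemma between: "r \<in> S \<Longrightarrow> t \<in> S \<Longrightarrow> r \<le> s \<Longrightarrow> s \<le> t \<Longrightarrow> s \<in> S"
  using interval_S unfolding is_interval_1 by blast

lemma p_pos: "s \<in> S \<Longrightarrow> 0 < s \<Longrightarrow> 0 < p s"
  using strict_mono_onD[OF mono zero_S] p_0 by fastforce

lemma p_neg: "s \<in> S \<Longrightarrow> s < 0 \<Longrightarrow> p s < 0"
  using strict_mono_onD[OF mono _ zero_S] p_0 by fastforce

lemma isCont_p: "s \<in> S \<Longrightarrow> isCont p s"
  using cont open_S by (simp add: continuous_on_eq_continuous_at)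

lemma continuous_P: "continuous_on S P"
  using der DERIV_isCont by (metis continuous_at_imp_continuous_on)

lemma P_less_pos:
  assumes "0 \<le> s" "s < t" "t \<in> S"
  shows "P s < P t"
proof (rule DERIV_pos_imp_increasing_open[where f = P and a = s and b = t])
  have sub: "{s..t} \<subseteq> S" using between[OF zero_S \<open>t \<in> S\<close>] assms by auto
  then show "continuous_on {s..t} P" using continuous_P by (rule continuous_on_subset[rotated])
  fix u assume u: "s < u" "u < t"
  then have "u \<in> S" using sub by auto
  then show "\<exists>y. (P has_real_derivative y) (at u) \<and> 0 < y"
    using u assms der[of u] p_pos[of u] by auto
qed fact

lemma reflection: "potential (uminus ` S) (\<lambda>s. - p (- s)) (\<lambda>s. P (- s))"
proof
  show "open (uminus ` S)" using open_S by (rule open_negations)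
  show "is_interval (uminus ` S)" using interval_S by (simp add: is_interval_neg_translationI)
  show "0 \<in> uminus ` S" using zero_S by force
  show "continuous_on (uminus ` S) (\<lambda>s. - p (- s))"
    by (intro continuous_on_minus continuous_on_compose2[OF cont] continuous_on_id) auto
  show "strict_mono_on (uminus ` S) (\<lambda>s. - p (- s))"
    using mono by (auto simp: strict_mono_on_def)
  show "- p (- 0) = 0" "P (- 0) = 0" using p_0 P_0 by auto
  fix s assume "s \<in> uminus ` S"
  then have "(P has_real_derivative p (- s)) (at (- s))" using der by auto
  then have "((\<lambda>s. P (- s)) has_real_derivative p (- s) * (- 1)) (at s)"
    by (rule DERIV_chain2) (auto intro!: derivative_eq_intros)
  then show "((\<lambda>s. P (- s)) has_real_derivative - p (- s)) (at s)" by simp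
qed

lemma P_less_neg: "s < t \<Longrightarrow> t \<le> 0 \<Longrightarrow> s \<in> S \<Longrightarrow> P t < P s"
  using potential.P_less_pos[OF reflection, of "- t" "- s"] by auto

lemma P_pos: "s \<in> S \<Longrightarrow> s \<noteq> 0 \<Longrightarrow> 0 < P s"
  using P_less_pos[of 0 s] P_less_neg[of s 0] P_0 by (cases "s < 0") auto

lemma P_nonneg: "s \<in> S \<Longrightarrow> 0 \<le> P s"
  using P_pos[of s] P_0 by (cases "s = 0") auto

lemma P_inj_pos: "0 \<le> s \<Longrightarrow> 0 \<le> t \<Longrightarrow> s \<in> S \<Longrightarrow> t \<in> S \<Longrightarrow> P s = P t \<Longrightarrow> s = t"
  using P_less_pos[of s t] P_less_pos[of t s] by (cases s t rule: linorder_cases) auto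

lemma level_nonneg:
  assumes "s \<in> S" "0 \<le> s" "0 \<le> k" "k \<le> P s"
  shows "\<exists>t\<in>S. 0 \<le> t \<and> P t = k"
proof -
  have sub: "{0..s} \<subseteq> S" using between[OF zero_S \<open>s \<in> S\<close>] by auto
  obtain t where "0 \<le> t" "t \<le> s" "P t = k"
    using IVT'[of P 0 k s] continuous_on_subset[OF continuous_P sub] assms P_0 by auto
  then show ?thesis using sub by auto
qed

lemma level_nonpos:
  assumes "s \<in> S" "s \<le> 0" "0 \<le> k" "k \<le> P s"
  shows "\<exists>t\<in>S. t \<le> 0 \<and> P t = k"
  using potential.level_nonneg[OF reflection, of "- s" k] assms by force

lemma coercive_right:
  assumes "S = UNIV" "0 \<le> k"
  shows "\<exists>s\<ge>0. k \<le> P s"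
proof -
  have p1: "p 1 > 0" using p_pos assms by simp
  \<comment> \<open>Beyond \<open>1\<close> the slope of \<open>P\<close> is at least \<open>p 1\<close>, so \<open>P\<close> gains at least \<open>p 1 + k\<close> between \<open>1\<close> and \<open>s\<close>.\<close>
  define s where "s = 2 + k / p 1"
  have s: "1 < s" unfolding s_def using divide_nonneg_pos[OF assms(2) p1] by linarith
  obtain z where z: "1 < z" "P s - P 1 = (s - 1) * p z"
    using MVT2[of 1 s P p] der assms s by auto
  have "p 1 \<le> p z" using strict_mono_onD[OF mono, of 1 z] z assms by simp
  then have "(s - 1) * p 1 \<le> P s - P 1" using z s by simp
  moreover have "(s - 1) * p 1 = p 1 + k" using p1 by (simp add: s_def field_simps)
  ultimately have "k \<le> P s" using P_nonneg[of 1] p1 assms by simp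
  with s show ?thesis by (intro exI[of _ s]) auto
qed

lemma coercive_left:
  assumes "S = UNIV" "0 \<le> k"
  shows "\<exists>s\<le>0. k \<le> P s"
  using potential.coercive_right[OF reflection, of k] assms
  by (metis neg_le_0_iff_le surj_uminus)

text \<open>Outside \<open>[\<alpha>, \<beta>]\<close> the function \<open>p\<close> is continued with slope \<open>1\<close>. That keeps it strictly
  increasing and makes the primitive unbounded on both sides.\<close>

lemma extends_to_line:
  assumes \<alpha>: "\<alpha> \<in> S" "\<alpha> \<le> 0" and \<beta>: "\<beta> \<in> S" "0 \<le> \<beta>"
  obtains p' P' where "potential UNIV p' P'" "\<forall>s\<in>{\<alpha>..\<beta>}. p' s = p s \<and> P' s = P s"
proof -
  define clamp where "clamp s = max \<alpha> (min \<beta> s)" for s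
  define p' where "p' s = p (clamp s) + (s - clamp s)" for s
  have clampS: "clamp s \<in> S" for s
    using between[OF \<alpha>(1) \<beta>(1)] \<alpha> \<beta> by (auto simp: clamp_def)
  have cont': "continuous_on UNIV p'"
    unfolding p'_def
    by (intro continuous_intros continuous_on_compose2[OF cont]) (use clampS in \<open>auto simp: clamp_def intro!: continuous_intros\<close>)
  have mono': "p' s < p' t" if "s < t" for s t
  proof (cases "clamp s = clamp t")
    case True
    then show ?thesis using that by (simp add: p'_def)
  next
    case False
    then have "clamp s < clamp t" using that by (auto simp: clamp_def min_def max_def split: if_splits)
    then have "p (clamp s) < p (clamp t)" by (rule strict_mono_onD[OF mono clampS clampS])
    moreover have "s - clamp s \<le> t - clamp t" using that \<alpha> \<beta> by (auto simp: clamp_def)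
    ultimately show ?thesis by (simp add: p'_def)
  qed
  have agree: "p' s = p s" if "s \<in> {\<alpha>..\<beta>}" for s using that by (auto simp: p'_def clamp_def)
  have "\<exists>Q. \<forall>x::real. -\<infinity> < ereal x \<longrightarrow> ereal x < \<infinity> \<longrightarrow> (Q has_vector_derivative p' x) (at x)"
    using cont' by (intro einterval_antiderivative) (auto simp: continuous_on_eq_continuous_at)
  then obtain Q where Q: "\<And>x. (Q has_real_derivative p' x) (at x)"
    by (auto simp: has_real_derivative_iff_has_vector_derivative)
  define P' where "P' s = Q s - Q 0" for s
  have P': "(P' has_real_derivative p' s) (at s)" for s
    unfolding P'_def using Q[of s] by (auto intro!: derivative_eq_intros)
  have "potential UNIV p' P'"
    by standard (use cont' mono' P' agree[of 0] \<alpha> \<beta> p_0 in \<open>auto simp: strict_mono_on_def P'_def\<close>)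
  moreover obtain c where c: "\<forall>s\<in>{\<alpha>..\<beta>}. P' s - P s = c"
  proof (atomize_elim, rule has_field_derivative_zero_constant)
    fix s assume s: "s \<in> {\<alpha>..\<beta>}"
    then have "s \<in> S" using between[OF \<alpha>(1) \<beta>(1)] by auto
    then have "((\<lambda>s. P' s - P s) has_real_derivative p' s - p s) (at s)"
      using P' der by (intro DERIV_diff) auto
    then show "((\<lambda>s. P' s - P s) has_real_derivative 0) (at s within {\<alpha>..\<beta>})"
      using agree[OF s] by (simp add: has_field_derivative_at_within)
  qed simp
  have "P' 0 - P 0 = c" using c \<alpha> \<beta> by auto
  then have "\<forall>s\<in>{\<alpha>..\<beta>}. P' s = P s"
    using c P_0 by (simp add: P'_def)
  ultimately show thesis using that agree by blast
qed

lemma inv_plus: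
  assumes S: "S = einterval \<alpha> \<beta>" and s: "s \<in> S" "0 \<le> s" and k: "0 \<le> k" "k \<le> P s"
  shows "inv_plus \<beta> P k \<in> S \<and> 0 \<le> inv_plus \<beta> P k \<and> P (inv_plus \<beta> P k) = k"
proof -
  let ?D = "{t. 0 \<le> t \<and> ereal t < \<beta>}"
  have D: "?D = {t \<in> S. 0 \<le> t}"
    using zero_S by (auto simp: S einterval_iff) (metis ereal_less_eq(3) less_le_trans zero_ereal_def)
  have inj: "inj_on P ?D" unfolding D by (rule inj_onI) (use P_inj_pos in auto)
  obtain t where t: "t \<in> ?D" "P t = k" using level_nonneg[OF s k] D by auto
  then have "inv_plus \<beta> P k = t" unfolding inv_plus_def using the_inv_into_f_f[OF inj] by blast
  then show ?thesis using t D by auto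
qed

lemma inv_minus:
  assumes S: "S = einterval \<alpha> \<beta>" and s: "s \<in> S" "s \<le> 0" and k: "0 \<le> k" "k \<le> P s"
  shows "inv_minus \<alpha> P k \<in> S \<and> inv_minus \<alpha> P k \<le> 0 \<and> P (inv_minus \<alpha> P k) = k"
proof -
  let ?D = "{t. \<alpha> < ereal t \<and> t \<le> 0}"
  have D: "?D = {t \<in> S. t \<le> 0}"
    using zero_S by (auto simp: S einterval_iff) (metis ereal_less_eq(3) le_less_trans zero_ereal_def)
  have inj: "inj_on P ?D" unfolding D
    by (rule linorder_inj_onI) (use P_less_neg in \<open>fastforce+\<close>)
  obtain t where t: "t \<in> ?D" "P t = k" using level_nonpos[OF s k] D by auto
  then have "inv_minus \<alpha> P k = t" unfolding inv_minus_def using the_inv_into_f_f[OF inj] by blast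
  then show ?thesis using t D by auto
qed

text \<open>By monotonicity the limit is a supremum, so an energy below it is reached inside the domain.\<close>

lemma below_limit_left:
  assumes S: "S = einterval \<alpha> \<beta>" and k: "ereal k < limit_left P \<beta>"
  shows "\<exists>s\<in>S. 0 \<le> s \<and> k \<le> P s"
proof -
  have \<beta>: "0 < \<beta>" and \<alpha>: "\<alpha> < 0" using zero_S by (auto simp: S einterval_iff zero_ereal_def)
  have inS: "t \<in> S" if "0 \<le> t" "ereal t < \<beta>" for t
    using that less_le_trans[OF \<alpha>, of "ereal t"] by (simp add: S einterval_iff)
  have "limit_left P \<beta> = (SUP t\<in>{t. 0 \<le> t \<and> ereal t < \<beta>}. ereal (P t))"
  proof (rule limit_left_mono[OF \<beta>])
    fix s t :: real assume "0 \<le> s" "s \<le> t" "ereal t < \<beta>"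
    then show "P s \<le> P t" using P_less_pos[of s t] inS[of t] by (cases "s = t") auto
  qed
  with k obtain t where "0 \<le> t" "ereal t < \<beta>" "k < P t" by (auto simp: less_SUP_iff)
  then show ?thesis using inS[of t] by (intro bexI[of _ t]) auto
qed

lemma below_limit_right:
  assumes S: "S = einterval \<alpha> \<beta>" and k: "ereal k < limit_right P \<alpha>"
  shows "\<exists>s\<in>S. s \<le> 0 \<and> k \<le> P s"
proof -
  have \<beta>: "0 < \<beta>" and \<alpha>: "\<alpha> < 0" using zero_S by (auto simp: S einterval_iff zero_ereal_def)
  have inS: "t \<in> S" if "t \<le> 0" "\<alpha> < ereal t" for t
    using that le_less_trans[OF _ \<beta>, of "ereal t"] by (simp add: S einterval_iff)
  have "limit_right P \<alpha> = (SUP t\<in>{t. \<alpha> < ereal t \<and> t \<le> 0}. ereal (P t))"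
  proof (rule limit_right_mono[OF \<alpha>])
    fix s t :: real assume "t \<le> 0" "s \<le> t" "\<alpha> < ereal s"
    then show "P t \<le> P s" using P_less_neg[of s t] inS[of s] by (cases "s = t") auto
  qed
  with k obtain t where "t \<le> 0" "\<alpha> < ereal t" "k < P t" by (auto simp: less_SUP_iff)
  then show ?thesis using inS[of t] by (intro bexI[of _ t]) auto
qed

end

lemma is_interval_einterval: "is_interval (einterval \<alpha> \<beta>)"
  unfolding is_interval_1
proof (intro ballI allI impI, elim conjE)
  fix r t s assume "r \<in> einterval \<alpha> \<beta>" "t \<in> einterval \<alpha> \<beta>" "r \<le> s" "s \<le> t"
  then show "s \<in> einterval \<alpha> \<beta>"
    using less_le_trans[of \<alpha> "ereal r" "ereal s"] le_less_trans[of "ereal s" "ereal t" \<beta>]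
    by (simp add: einterval_iff)
qed

lemma primitive_has_derivative:
  assumes p: "continuous_on (einterval \<alpha> \<beta>) p" and zero: "0 \<in> einterval \<alpha> \<beta>"
    and s: "s \<in> einterval \<alpha> \<beta>"
  shows "(primitive p has_real_derivative p s) (at s)"
proof -
  have "min 0 s \<in> einterval \<alpha> \<beta>" "max 0 s \<in> einterval \<alpha> \<beta>" using zero s by (auto simp: min_def max_def)
  then obtain d e where d: "0 < d" "ball (min 0 s) d \<subseteq> einterval \<alpha> \<beta>"
    and e: "0 < e" "ball (max 0 s) e \<subseteq> einterval \<alpha> \<beta>"
    using open_einterval[of \<alpha> \<beta>] unfolding open_contains_ball by blast
  define l where "l = min 0 s - d / 2"
  define u where "u = max 0 s + e / 2"
  have "l \<in> ball (min 0 s) d" "u \<in> ball (max 0 s) e" using d e by (auto simp: l_def u_def dist_real_def)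
  then have "l \<in> einterval \<alpha> \<beta>" "u \<in> einterval \<alpha> \<beta>" using d(2) e(2) by blast+
  then have sub: "{l..u} \<subseteq> einterval \<alpha> \<beta>"
    using is_interval_1[THEN iffD1, OF is_interval_einterval[of \<alpha> \<beta>]]
    by (meson atLeastAtMost_iff subsetI)
  have lu: "l < 0" "0 < u" "l < s" "s < u" using d e by (auto simp: l_def u_def)
  have "((\<lambda>t. LBINT y=ereal 0..ereal t. p y) has_vector_derivative p s) (at s within {l..u})"
    by (rule interval_integral_FTC2) (use lu continuous_on_subset[OF p sub] in auto)
  moreover have "(\<lambda>t. LBINT y=ereal 0..ereal t. p y) = primitive p"
    by (simp add: fun_eq_iff primitive_def zero_ereal_def)
  moreover have "at s within {l..u} = at s" by (rule at_within_interior) (use lu in auto)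
  ultimately show ?thesis by (simp add: has_real_derivative_iff_has_vector_derivative)
qed

lemma potential_primitive:
  assumes "continuous_on (einterval \<alpha> \<beta>) p" "strict_mono_on (einterval \<alpha> \<beta>) p"
    "0 \<in> einterval \<alpha> \<beta>" "p 0 = 0"
  shows "potential (einterval \<alpha> \<beta>) p (primitive p)"
proof
  show "primitive p 0 = 0" by (simp add: primitive_def zero_ereal_def[symmetric])
qed (use assms primitive_has_derivative is_interval_einterval in auto)

section \<open>Trajectories and their uniqueness\<close>

definition trajectory ::
  "real set \<Rightarrow> (real \<Rightarrow> real) \<Rightarrow> real set \<Rightarrow> (real \<Rightarrow> real) \<Rightarrow> real set \<Rightarrow> (real \<Rightarrow> real) \<Rightarrow> (real \<Rightarrow> real) \<Rightarrow> bool"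
  where "trajectory A f B h I x v \<longleftrightarrow> (\<forall>t\<in>I. x t \<in> A \<and> v t \<in> B \<and>
      (x has_real_derivative h (v t)) (at t) \<and> (v has_real_derivative - f (x t)) (at t))"

lemma trajectory_rotate:
  assumes "trajectory A f B h I x v"
  shows "trajectory B h (uminus ` A) (\<lambda>s. - f (- s)) I v (\<lambda>t. - x t)"
  using assms unfolding trajectory_def by (auto intro!: derivative_eq_intros)

lemma trajectory_continuous:
  assumes "trajectory A f B h I x v"
  shows "continuous_on I x" "continuous_on I v"
  using assms unfolding trajectory_def
  by (auto intro!: continuous_at_imp_continuous_on intro: DERIV_isCont)

locale oscillator = A: potential A f F + B: potential B h G
  for A f F B h G

begin

abbreviation "traj \<equiv> trajectory A f B h"

text \<open>The quarter turn \<open>(x, v) \<mapsto> (v, -x)\<close> of the phase plane exchanges the roles of position and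
  momentum; see \<open>trajectory_rotate\<close>.\<close>

lemma rotate: "oscillator B h G (uminus ` A) (\<lambda>s. - f (- s)) (\<lambda>s. F (- s))"
  using B.potential_axioms A.reflection by (rule oscillator.intro)

lemma energy_constant:
  assumes tr: "traj I x v" and I: "is_interval I" and st: "s \<in> I" "t \<in> I"
  shows "F (x s) + G (v s) = F (x t) + G (v t)"
proof -
  have "\<exists>c. \<forall>t\<in>I. F (x t) + G (v t) = c"
  proof (rule has_field_derivative_zero_constant)
    show "convex I" using I by (simp add: is_interval_convex)
    fix t assume t: "t \<in> I"
    have "((\<lambda>t. F (x t) + G (v t)) has_real_derivative f (x t) * h (v t) + h (v t) * (- f (x t))) (at t)"
      by (intro DERIV_add DERIV_chain2[OF A.der] DERIV_chain2[OF B.der])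
        (use tr t in \<open>auto simp: trajectory_def\<close>)
    then show "((\<lambda>t. F (x t) + G (v t)) has_field_derivative 0) (at t within I)"
      by (simp add: has_field_derivative_at_within mult.commute)
  qed
  then show ?thesis using st by auto
qed

text \<open>Near \<open>t0\<close> the position \<open>x\<close> is strictly increasing; let \<open>\<xi>\<close> be its inverse. By conservation of
  energy, \<open>\<xi> (y t)\<close> has derivative \<open>1\<close>, so it equals \<open>t\<close>.\<close>

lemma coincide_near_moving_right:
  assumes tr: "traj I x v" "traj I y w" and I: "open I" "is_interval I" and t0: "t0 \<in> I"
    and eq: "x t0 = y t0" "v t0 = w t0" and pos: "0 < v t0"
  shows "\<exists>d>0. \<forall>t\<in>ball t0 d. x t = y t \<and> v t = w t"
proof -
  have cont: "continuous_on I x" "continuous_on I v" "continuous_on I y" "continuous_on I w"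
    using tr trajectory_continuous by blast+
  have "open ((I \<inter> v -` {0<..}) \<inter> (I \<inter> w -` {0<..}))"
    by (intro open_Int continuous_open_preimage cont I open_greaterThan)
  also have "(I \<inter> v -` {0<..}) \<inter> (I \<inter> w -` {0<..}) = {t \<in> I. 0 < v t \<and> 0 < w t}" by auto
  finally have "open {t \<in> I. 0 < v t \<and> 0 < w t}" .
  then obtain e where e: "0 < e" "cball t0 e \<subseteq> {t \<in> I. 0 < v t \<and> 0 < w t}"
    using t0 eq pos unfolding open_contains_cball by force
  define a where "a = t0 - e"
  define b where "b = t0 + e"
  have ab: "a < b" "t0 \<in> {a<..<b}" using e by (auto simp: a_def b_def)
  have near: "t \<in> I" "0 < v t" "0 < w t" if "t \<in> {a..b}" for t
  proof -
    have "t \<in> cball t0 e" using that by (auto simp: a_def b_def dist_real_def)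
    with e show "t \<in> I" "0 < v t" "0 < w t" by auto
  qed
  have xa: "(x has_real_derivative h (v t)) (at t)" "0 < h (v t)" if "t \<in> {a..b}" for t
    using near[OF that] tr(1) B.p_pos by (auto simp: trajectory_def)
  have contx: "continuous_on {a..b} x" using near by (auto intro: continuous_on_subset[OF cont(1)])
  have ab': "t \<in> {a..b}" if "t \<in> {a<..<b}" for t using that by auto
  obtain \<xi> where "continuous_on {x a..x b} \<xi>" and \<xi>: "\<forall>t\<in>{a..b}. \<xi> (x t) = t"
    "\<forall>r\<in>{x a..x b}. \<xi> r \<in> {a..b} \<and> x (\<xi> r) = r"
    "\<forall>r\<in>{x a<..<x b}. \<xi> r \<in> {a<..<b} \<and> (\<xi> has_real_derivative 1 / h (v (\<xi> r))) (at r)"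
    by (rule increasing_C1_inverse[OF ab(1) contx xa(1)[OF ab'] xa(2)[OF ab']])
  note \<xi> = \<xi>[rule_format]
  have "x s < x t" if "a \<le> s" "s < t" "t \<le> b" for s t
  proof (rule DERIV_pos_imp_increasing[OF \<open>s < t\<close>])
    show "\<exists>y. (x has_real_derivative y) (at u) \<and> 0 < y" if "s \<le> u" "u \<le> t" for u
      using xa[of u] that \<open>a \<le> s\<close> \<open>t \<le> b\<close> by auto
  qed
  then have "x a < x t0" "x t0 < x b" using ab by auto
  then have "y t0 \<in> {x a<..<x b}" using eq by simp
  have "open ((I \<inter> y -` {x a<..<x b}) \<inter> {a<..<b})"
    by (intro open_Int continuous_open_preimage cont I open_greaterThanLessThan)
  also have "I \<inter> y -` {x a<..<x b} = {t \<in> I. y t \<in> {x a<..<x b}}" by auto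
  finally have "open ({t \<in> I. y t \<in> {x a<..<x b}} \<inter> {a<..<b})" .
  then obtain d where d: "0 < d" "ball t0 d \<subseteq> {t \<in> I. y t \<in> {x a<..<x b}} \<inter> {a<..<b}"
    using t0 \<open>y t0 \<in> _\<close> ab unfolding open_contains_ball by blast
  \<comment> \<open>At time \<open>t\<close> the second trajectory is where the first one is at time \<open>\<xi> (y t)\<close>. Equal positions and
    equal energies force equal positive momenta, so both pass there at the same speed.\<close>
  have H: "w t = v (\<xi> (y t)) \<and> x (\<xi> (y t)) = y t \<and> ((\<lambda>t. \<xi> (y t)) has_real_derivative 1) (at t)"
    if t: "t \<in> ball t0 d" for t
  proof -
    have tI: "t \<in> I" "y t \<in> {x a<..<x b}" "t \<in> {a..b}" using t d by auto
    let ?s = "\<xi> (y t)"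
    have s: "?s \<in> {a..b}" "x ?s = y t" using \<xi>(2)[of "y t"] tI by auto
    have "F (x ?s) + G (v ?s) = F (x t0) + G (v t0)"
      using energy_constant[OF tr(1) I(2)] near s t0 by blast
    also have "\<dots> = F (y t) + G (w t)"
      using energy_constant[OF tr(2) I(2), of t0 t] tI t0 eq by simp
    finally have "G (v ?s) = G (w t)" using s by simp
    then have vw: "v ?s = w t"
      using B.P_inj_pos near[OF s(1)] near[OF tI(3)] tr tI by (simp add: trajectory_def)
    have "((\<lambda>t. \<xi> (y t)) has_real_derivative 1 / h (v ?s) * h (w t)) (at t)"
      by (rule DERIV_chain2) (use \<xi>(3)[OF tI(2)] tr(2) tI in \<open>auto simp: trajectory_def\<close>)
    then show ?thesis using vw s xa(2)[OF s(1)] by simp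
  qed
  have "\<exists>c. \<forall>t\<in>ball t0 d. \<xi> (y t) - t = c"
  proof (rule has_field_derivative_zero_constant)
    fix t assume "t \<in> ball t0 d"
    then have "((\<lambda>t. \<xi> (y t) - t) has_real_derivative 1 - 1) (at t)"
      using H by (intro DERIV_diff DERIV_ident) auto
    then show "((\<lambda>t. \<xi> (y t) - t) has_real_derivative 0) (at t within ball t0 d)"
      by (simp add: has_field_derivative_at_within)
  qed (rule convex_ball)
  then obtain c where c: "\<And>t. t \<in> ball t0 d \<Longrightarrow> \<xi> (y t) - t = c" by blast
  have "\<xi> (y t0) = t0" using \<xi>(1)[of t0] eq ab by simp
  then have "c = 0" using c[of t0] d by simp
  then have "\<xi> (y t) = t" if "t \<in> ball t0 d" for t using c[OF that] by simp
  then show ?thesis using H d(1) by metis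
qed

text \<open>Turning the phase plane by multiples of a quarter turn makes whichever coordinate is nonzero a
  positive momentum.\<close>

lemma coincide_near:
  assumes tr: "traj I x v" "traj I y w" and I: "open I" "is_interval I" and t0: "t0 \<in> I"
    and eq: "x t0 = y t0" "v t0 = w t0" and ne: "x t0 \<noteq> 0 \<or> v t0 \<noteq> 0"
  shows "\<exists>d>0. \<forall>t\<in>ball t0 d. x t = y t \<and> v t = w t"
proof -
  interpret r1: oscillator B h G "uminus ` A" "\<lambda>s. - f (- s)" "\<lambda>s. F (- s)" by (rule rotate)
  note R1 = r1.rotate
  note R2 = oscillator.rotate[OF R1]
  note T1 = tr[THEN trajectory_rotate]
  note T2 = T1[THEN trajectory_rotate]
  note T3 = T2[THEN trajectory_rotate]
  consider "0 < v t0" | "x t0 < 0" | "v t0 < 0" | "0 < x t0" using ne by linarith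
  then show ?thesis
  proof cases
    case 1 then show ?thesis using coincide_near_moving_right[OF tr I t0 eq] by simp
  next
    case 2 then show ?thesis using r1.coincide_near_moving_right[OF T1 I t0] eq by auto
  next
    case 3 then show ?thesis
      using oscillator.coincide_near_moving_right[OF R1 T2 I t0] eq by auto
  next
    case 4 then show ?thesis
      using oscillator.coincide_near_moving_right[OF R2 T3 I t0] eq by auto
  qed
qed

theorem unique_trajectory:
  assumes tr: "traj I x v" "traj I y w" and I: "open I" "is_interval I" and a: "a \<in> I"
    and eq: "x a = y a" "v a = w a" and t: "t \<in> I"
  shows "x t = y t \<and> v t = w t"
proof (cases "x a = 0 \<and> v a = 0")
  case True
  have rest: "x t = 0 \<and> v t = 0" if tr: "traj I x v" and xa: "x a = 0" "v a = 0" for x v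
  proof -
    have "F (x t) + G (v t) = 0"
      using energy_constant[OF tr I(2) t a] xa A.P_0 B.P_0 by simp
    moreover have "x t \<in> A" "v t \<in> B" using tr t by (auto simp: trajectory_def)
    ultimately show ?thesis
      using A.P_pos[of "x t"] B.P_pos[of "v t"] A.P_nonneg[of "x t"] B.P_nonneg[of "v t"]
      by (smt (verit))
  qed
  show ?thesis using rest[OF tr(1)] rest[OF tr(2)] True eq by simp
next
  case False
  let ?E = "{t \<in> I. (x t - y t, v t - w t) = (0, 0)}"
  have "x a \<in> A" "v a \<in> B" using tr(1) a by (auto simp: trajectory_def)
  then have energy_pos: "0 < F (x a) + G (v a)"
    using False A.P_pos[of "x a"] B.P_pos[of "v a"] A.P_nonneg[of "x a"] B.P_nonneg[of "v a"]
    by (smt (verit))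
  have "\<forall>t\<in>I. (x t - y t, v t - w t) = (0, 0)"
  proof (rule continuous_levelset_openin)
    show "connected I" using I(2) by (simp add: is_interval_connected)
    show "continuous_on I (\<lambda>t. (x t - y t, v t - w t))"
      by (intro continuous_intros trajectory_continuous[OF tr(1)] trajectory_continuous[OF tr(2)])
    have "open ?E"
      unfolding open_contains_ball
    proof
      fix s assume s: "s \<in> ?E"
      have "0 < F (x s) + G (v s)" using energy_pos energy_constant[OF tr(1) I(2), of s a] s a by simp
      then have "x s \<noteq> 0 \<or> v s \<noteq> 0" using A.P_0 B.P_0 by auto
      then obtain d where d: "d > 0" "\<forall>t\<in>ball s d. x t = y t \<and> v t = w t"
        using coincide_near[OF tr I, of s] s by auto
      obtain e where e: "e > 0" "ball s e \<subseteq> I" using I(1) s unfolding open_contains_ball by blast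
      have "ball s (min d e) \<subseteq> ?E" using d e by (auto simp: subset_iff)
      then show "\<exists>e>0. ball s e \<subseteq> ?E" using d(1) e(1) by (intro exI[of _ "min d e"]) simp
    qed
    then show "openin (top_of_set I) ?E" by (rule open_subset[rotated]) auto
    show "\<exists>t\<in>I. (x t - y t, v t - w t) = (0, 0)" using a eq by auto
  qed
  then show ?thesis using t by auto
qed

section \<open>Closed orbits\<close>

text \<open>The motion from the left turning point \<open>xm\<close> to the right one \<open>xp\<close> along the graph of \<open>V\<close>, in
  time \<open>L\<close>. It is obtained by inverting the time of passage \<open>\<Phi>\<close>, an antiderivative of
  \<open>1 / h (V r)\<close>. To see that \<open>\<Phi>\<close> is bounded near \<open>xp\<close>, use that \<open>V\<close> has derivative
  \<open>- f r / h (V r)\<close>: for \<open>r \<ge> xp / 2\<close> the sum \<open>\<Phi> r + V r / f (xp / 2)\<close> is decreasing while its second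
  term is nonnegative. The same works at \<open>xm\<close> with \<open>f (xm / 2) < 0\<close>. The bounded monotone \<open>\<Phi>\<close> has
  limits at both ends, and their difference is the improper integral.\<close>

lemma half_orbit:
  assumes xm: "xm \<in> A" "xm < 0" "F xm = k" and xp: "xp \<in> A" "0 < xp" "F xp = k"
    and V: "\<And>r. r \<in> {xm<..<xp} \<Longrightarrow> V r \<in> B \<and> 0 \<le> V r \<and> G (V r) = k - F r"
  obtains x v L where "0 < L" "continuous_on {0..L} x" "continuous_on {0..L} v"
    "x 0 = xm" "x L = xp" "v 0 = 0" "v L = 0"
    "\<forall>t\<in>{0..L}. x t \<in> {xm..xp} \<and> v t \<in> B \<and> 0 \<le> v t \<and> F (x t) + G (v t) = k"
    "\<forall>t\<in>{0<..<L}. x t \<in> {xm<..<xp} \<and> (x has_real_derivative h (v t)) (at t)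
      \<and> (v has_real_derivative - f (x t)) (at t)"
    "interval_lebesgue_integrable lborel (ereal xm) (ereal xp) (\<lambda>r. 1 / h (V r))"
    "(LBINT r=ereal xm..ereal xp. 1 / h (V r)) = L"
proof -
  have mp: "xm < xp" using xm xp by simp
  have inA: "r \<in> A" if "r \<in> {xm..xp}" for r using A.between[OF xm(1) xp(1)] that by auto
  have Fk: "F r < k" if "r \<in> {xm<..<xp}" for r
    using A.P_less_pos[of r xp] A.P_less_neg[of xm r] that xm xp by (cases "r < 0") auto
  have Fk': "F r \<le> k" if "r \<in> {xm..xp}" for r
    using Fk[of r] that xm xp by (cases "r = xm \<or> r = xp") auto
  have F0: "0 \<le> F r" if "r \<in> {xm..xp}" for r using A.P_nonneg inA that by auto
  have V0: "V 0 \<in> B" "0 \<le> V 0" "G (V 0) = k" using V[of 0] xm xp A.P_0 by auto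
  obtain e where e: "0 < e" "ball (V 0) e \<subseteq> B"
    using B.open_S V0 unfolding open_contains_ball by blast
  \<comment> \<open>\<open>top\<close> lies beyond the maximal momentum \<open>V 0\<close>, so that the inverse of \<open>G\<close> is differentiable at \<open>k\<close>.\<close>
  define top where "top = V 0 + e / 2"
  have top: "top \<in> B" "V 0 < top" using e by (auto simp: top_def subset_iff dist_real_def)
  have Gtop: "k < G top" using B.P_less_pos[OF V0(2) top(2,1)] V0 by simp
  have topB: "s \<in> B" if "s \<in> {0..top}" for s using B.between[OF B.zero_S top(1)] that by auto
  have contG: "continuous_on {0..top} G"
    using B.continuous_P by (rule continuous_on_subset) (use topB in auto)
  have derG: "(G has_real_derivative h s) (at s)" "0 < h s" if "s \<in> {0<..<top}" for s
    using B.der[of s] B.p_pos[of s] topB[of s] that by auto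
  have "0 < top" using V0 top by simp
  obtain \<gamma> where c\<gamma>: "continuous_on {G 0..G top} \<gamma>" and \<gamma>: "\<forall>t\<in>{0..top}. \<gamma> (G t) = t"
    "\<forall>r\<in>{G 0..G top}. \<gamma> r \<in> {0..top} \<and> G (\<gamma> r) = r"
    "\<forall>r\<in>{G 0<..<G top}. \<gamma> r \<in> {0<..<top} \<and> (\<gamma> has_real_derivative 1 / h (\<gamma> r)) (at r)"
    by (rule increasing_C1_inverse[OF \<open>0 < top\<close> contG derG])
  note c\<gamma> = c\<gamma>[unfolded B.P_0] and \<gamma> = \<gamma>[rule_format, unfolded B.P_0]
  define W where "W r = \<gamma> (k - F r)" for r
  have kF: "k - F r \<in> {0..G top}" if "r \<in> {xm..xp}" for r
    using Fk' F0 Gtop that by force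
  have kF': "k - F r \<in> {0<..<G top}" if "r \<in> {xm<..<xp}" for r
    using Fk[OF that] F0[of r] Gtop that by auto
  have W: "W r \<in> B" "0 \<le> W r" "G (W r) = k - F r" if "r \<in> {xm..xp}" for r
    using \<gamma>(2)[OF kF[OF that]] topB by (auto simp: W_def)
  have W': "0 < W r" if "r \<in> {xm<..<xp}" for r
    using \<gamma>(3)[OF kF'[OF that]] by (auto simp: W_def)
  have WV: "V r = W r" if "r \<in> {xm<..<xp}" for r
    using B.P_inj_pos[of "V r" "W r"] V[OF that] W[of r] that by auto
  have Wend: "W xm = 0" "W xp = 0"
    using \<gamma>(1)[of 0] \<open>0 < top\<close> xm xp B.P_0 by (auto simp: W_def)
  have contW: "continuous_on {xm..xp} W"
    unfolding W_def
    by (intro continuous_on_compose2[OF c\<gamma>] continuous_intros continuous_on_subset[OF A.continuous_P])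
      (use kF inA in auto)
  have derW: "(W has_real_derivative 1 / h (W r) * - f r) (at r)" if "r \<in> {xm<..<xp}" for r
  proof -
    have "((\<lambda>r. k - F r) has_real_derivative - f r) (at r)"
      using A.der[OF inA, of r] that by (auto intro!: derivative_eq_intros)
    then show ?thesis
      unfolding W_def using \<gamma>(3)[OF kF'[OF that]] by (intro DERIV_chain2[where f = \<gamma>]) auto
  qed
  define \<phi> where "\<phi> r = 1 / h (W r)" for r
  have hW: "0 < h (W r)" if "r \<in> {xm<..<xp}" for r
    using B.p_pos W W'[OF that] that by auto
  have \<phi>pos: "0 < \<phi> r" if "r \<in> {xm<..<xp}" for r
    using hW[OF that] by (simp add: \<phi>_def)
  have cont\<phi>: "isCont \<phi> r" if "r \<in> {xm<..<xp}" for r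
  proof -
    have "isCont h (W r)" using B.isCont_p W that by auto
    moreover have "isCont W r" using derW[OF that] by (rule DERIV_isCont)
    ultimately have "isCont (\<lambda>r. h (W r)) r" by (rule isCont_o2[rotated])
    then show ?thesis unfolding \<phi>_def using hW[OF that] by (intro continuous_intros) auto
  qed
  \<comment> \<open>\<open>\<Phi> r\<close> is the time at which the trajectory passes position \<open>r\<close>, up to a constant.\<close>
  obtain \<Phi> where \<Phi>0: "\<forall>r. ereal xm < ereal r \<longrightarrow> ereal r < ereal xp \<longrightarrow> (\<Phi> has_vector_derivative \<phi> r) (at r)"
    using einterval_antiderivative[of "ereal xm" "ereal xp" \<phi>] cont\<phi> mp by auto
  then have \<Phi>: "(\<Phi> has_real_derivative \<phi> r) (at r)" if "r \<in> {xm<..<xp}" for r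
    using that by (simp add: has_real_derivative_iff_has_vector_derivative)
  have incr: "\<Phi> r \<le> \<Phi> s" if "xm < r" "r \<le> s" "s < xp" for r s
  proof (rule DERIV_nonneg_imp_nondecreasing[OF \<open>r \<le> s\<close>])
    fix u assume "r \<le> u" "u \<le> s"
    then have "u \<in> {xm<..<xp}" using that by auto
    then show "\<exists>y. (\<Phi> has_real_derivative y) (at u) \<and> 0 \<le> y" using \<Phi> \<phi>pos by (meson less_imp_le)
  qed
  have f0: "f (xm / 2) < 0" "0 < f (xp / 2)"
    using A.p_neg[of "xm / 2"] A.p_pos[of "xp / 2"] inA xm xp by auto
  \<comment> \<open>\<open>\<Phi> + W / c\<close> has the derivative \<open>\<phi> u * (1 - f u / c)\<close> at \<open>u\<close>.\<close>
  have decr: "\<Phi> s + W s / c \<le> \<Phi> r + W r / c"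
    if c: "\<And>u. r \<le> u \<Longrightarrow> u \<le> s \<Longrightarrow> 1 \<le> f u / c" and rs: "xm < r" "r \<le> s" "s < xp" for r s c
  proof (rule DERIV_nonpos_imp_nonincreasing[OF \<open>r \<le> s\<close>, where f = "\<lambda>r. \<Phi> r + W r / c"])
    fix u assume u: "r \<le> u" "u \<le> s"
    then have uI: "u \<in> {xm<..<xp}" using rs by auto
    have "((\<lambda>r. \<Phi> r + W r / c) has_real_derivative \<phi> u + 1 / h (W u) * - f u / c) (at u)"
      by (intro DERIV_add DERIV_cdivide \<Phi> derW uI)
    also have "\<phi> u + 1 / h (W u) * - f u / c = \<phi> u * (1 - f u / c)"
      by (simp add: \<phi>_def algebra_simps)
    finally show "\<exists>y. ((\<lambda>r. \<Phi> r + W r / c) has_real_derivative y) (at u) \<and> y \<le> 0"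
      using c[OF u] \<phi>pos[OF uI] by (intro exI conjI) (auto intro!: mult_nonneg_nonpos)
  qed
  have fle: "f r \<le> f s" if "r \<in> A" "s \<in> A" "r \<le> s" for r s
    using strict_mono_onD[OF A.mono that(1,2)] that(3) by (cases "r = s") auto
  define u where "u = \<Phi> (xp / 2) + W (xp / 2) / f (xp / 2)"
  define l where "l = \<Phi> (xm / 2) + W (xm / 2) / f (xm / 2)"
  have upper: "\<Phi> r \<le> u" if "xp / 2 \<le> r" "r < xp" for r
  proof -
    have "\<Phi> r + W r / f (xp / 2) \<le> u"
      unfolding u_def
    proof (rule decr)
      fix u assume "xp / 2 \<le> u" "u \<le> r"
      then have "f (xp / 2) \<le> f u" using xm xp that inA by (intro fle) auto
      then show "1 \<le> f u / f (xp / 2)" using f0 by simp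
    qed (use xm xp that in auto)
    moreover have "0 \<le> W r / f (xp / 2)" using W(2)[of r] f0 that xm xp by auto
    ultimately show ?thesis by simp
  qed
  have lower: "l \<le> \<Phi> r" if "xm < r" "r \<le> xm / 2" for r
  proof -
    have "l \<le> \<Phi> r + W r / f (xm / 2)"
      unfolding l_def
    proof (rule decr)
      fix u assume "r \<le> u" "u \<le> xm / 2"
      then have "f u \<le> f (xm / 2)" using xm xp that inA by (intro fle) auto
      then show "1 \<le> f u / f (xm / 2)" using f0 by (simp add: le_divide_eq)
    qed (use xm xp that in auto)
    moreover have "W r / f (xm / 2) \<le> 0"
      using W(2)[of r] f0 that xm xp by (auto intro!: divide_nonneg_neg)
    ultimately show ?thesis by simp
  qed
  have bound: "l \<le> \<Phi> r \<and> \<Phi> r \<le> u" if "xm < r" "r < xp" for r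
  proof
    show "l \<le> \<Phi> r"
      using lower[of r] lower[of "xm / 2"] incr[of "xm / 2" r] that xm xp
      by (cases "r \<le> xm / 2") auto
    show "\<Phi> r \<le> u"
      using upper[of r] upper[of "xp / 2"] incr[of r "xp / 2"] that xm xp
      by (cases "xp / 2 \<le> r") auto
  qed
  obtain Lm Lp where L: "(\<Phi> \<longlongrightarrow> Lm) (at_right xm)" "(\<Phi> \<longlongrightarrow> Lp) (at_left xp)"
    by (rule increasing_limits[OF mp incr bound])
  have int: "set_integrable lborel (einterval (ereal xm) (ereal xp)) \<phi>"
    "(LBINT r=ereal xm..ereal xp. \<phi> r) = Lp - Lm"
    by (rule interval_integral_FTC_nonneg[where F = \<Phi>];
      use mp \<Phi> cont\<phi> \<phi>pos L in \<open>auto simp: ereal_tendsto_simps intro!: less_imp_le\<close>)+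
  \<comment> \<open>Extended by its limits, the time of passage becomes a homeomorphism of compact intervals;
    its inverse is the position.\<close>
  define \<Psi> where "\<Psi> r = (if r \<le> xm then Lm else if xp \<le> r then Lp else \<Phi> r)" for r
  have \<Psi>: "(\<Psi> has_real_derivative \<phi> r) (at r)" if "r \<in> {xm<..<xp}" for r
    by (rule has_field_derivative_transform_within_open[OF \<Phi>[OF that] open_greaterThanLessThan that])
      (auto simp: \<Psi>_def)
  have cont\<Psi>: "continuous_on {xm..xp} \<Psi>"
  proof (rule continuous_on_IccI)
    show "(\<Psi> \<longlongrightarrow> \<Psi> xm) (at_right xm)"
      by (rule Lim_transform_eventually[of \<Phi>])
        (use L mp in \<open>auto simp: \<Psi>_def eventually_at_right_field intro!: exI[of _ xp]\<close>)
    show "(\<Psi> \<longlongrightarrow> \<Psi> xp) (at_left xp)"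
      by (rule Lim_transform_eventually[of \<Phi>])
        (use L mp in \<open>auto simp: \<Psi>_def eventually_at_left_field intro!: exI[of _ xm]\<close>)
    show "\<Psi> \<midarrow>r\<rightarrow> \<Psi> r" if "xm < r" "r < xp" for r
      using DERIV_isCont[OF \<Psi>, of r] that by (auto simp: isCont_def)
  qed (use mp in auto)
  have \<Psi>end: "\<Psi> xm = Lm" "\<Psi> xp = Lp" using mp by (auto simp: \<Psi>_def)
  obtain y where cy: "continuous_on {\<Psi> xm..\<Psi> xp} y" and y: "\<forall>t\<in>{xm..xp}. y (\<Psi> t) = t"
    "\<forall>r\<in>{\<Psi> xm..\<Psi> xp}. y r \<in> {xm..xp} \<and> \<Psi> (y r) = r"
    "\<forall>r\<in>{\<Psi> xm<..<\<Psi> xp}. y r \<in> {xm<..<xp} \<and> (y has_real_derivative 1 / \<phi> (y r)) (at r)"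
    by (rule increasing_C1_inverse[OF mp cont\<Psi> \<Psi> \<phi>pos])
  note cy = cy[unfolded \<Psi>end] and y = y[rule_format, unfolded \<Psi>end]
  define L where "L = Lp - Lm"
  have "\<Psi> xm < \<Psi> xp"
    using mp \<Psi> \<phi>pos cont\<Psi> by (intro DERIV_pos_imp_increasing_open[where f = \<Psi>]) auto
  then have Lpos: "0 < L" by (simp add: L_def \<Psi>end)
  define x where "x t = y (Lm + t)" for t
  define v where "v t = W (x t)" for t
  have xI: "x t \<in> {xm..xp}" if "t \<in> {0..L}" for t
    using y(2)[of "Lm + t"] that by (auto simp: x_def L_def)
  have contx: "continuous_on {0..L} x"
    unfolding x_def by (intro continuous_on_compose2[OF cy] continuous_intros) (auto simp: L_def)
  have contv: "continuous_on {0..L} v"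
    unfolding v_def by (rule continuous_on_compose2[OF contW contx]) (use xI in auto)
  have ends: "x 0 = xm" "x L = xp" using y(1)[of xm] y(1)[of xp] mp by (auto simp: x_def L_def \<Psi>end)
  have "x t \<in> {xm<..<xp} \<and> (x has_real_derivative h (v t)) (at t)
      \<and> (v has_real_derivative - f (x t)) (at t)" if t: "t \<in> {0<..<L}" for t
  proof -
    have "Lm + t \<in> {Lm<..<Lp}" using t by (auto simp: L_def)
    from y(3)[OF this] have xt: "x t \<in> {xm<..<xp}"
      and dy: "(y has_real_derivative h (v t)) (at (Lm + t))"
      by (auto simp: x_def v_def \<phi>_def)
    have "((\<lambda>t. y (Lm + t)) has_real_derivative h (v t) * 1) (at t)"
      by (rule DERIV_chain2[where f = y and g = "\<lambda>t. Lm + t", OF dy]) (auto intro!: derivative_eq_intros)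
    then have dx: "(x has_real_derivative h (v t)) (at t)" by (simp add: x_def[abs_def])
    have "(v has_real_derivative (1 / h (W (x t)) * - f (x t)) * h (v t)) (at t)"
      unfolding v_def by (rule DERIV_chain2[OF derW[OF xt] dx[unfolded v_def]])
    moreover have "h (W (x t)) \<noteq> 0" using hW[OF xt] by simp
    ultimately have "(v has_real_derivative - f (x t)) (at t)" by (simp add: v_def)
    with xt dx show ?thesis by blast
  qed
  note ode = this
  have "set_integrable lborel {xm<..<xp} (\<lambda>r. 1 / h (V r)) \<longleftrightarrow> set_integrable lborel {xm<..<xp} \<phi>"
    by (rule set_integrable_cong) (auto simp: \<phi>_def WV)
  then have int1: "interval_lebesgue_integrable lborel (ereal xm) (ereal xp) (\<lambda>r. 1 / h (V r))"
    using int(1) mp by (simp add: interval_lebesgue_integrable_def)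
  have int2: "(LBINT r=ereal xm..ereal xp. 1 / h (V r)) = L"
    unfolding L_def int(2)[symmetric]
    by (rule interval_integral_cong) (use mp WV in \<open>auto simp: \<phi>_def min_def max_def\<close>)
  show thesis
    by (rule that[OF Lpos contx contv ends])
      (use xI W ode Wend ends int1 int2 in \<open>auto simp: v_def\<close>)
qed

text \<open>The position rises from \<open>xm\<close> to \<open>xp\<close> with momentum \<open>Vp \<ge> 0\<close> and falls back with momentum
  \<open>Vm \<le> 0\<close>. The last conclusion says that the orbit exhausts its energy level: a position with
  \<open>F c \<le> k\<close> is passed on both halves, and there the energy determines the momentum up to its sign.\<close>

theorem closed_orbit:
  assumes xm: "xm \<in> A" "xm < 0" "F xm = k" and xp: "xp \<in> A" "0 < xp" "F xp = k"
    and Vp: "\<And>r. r \<in> {xm<..<xp} \<Longrightarrow> Vp r \<in> B \<and> 0 \<le> Vp r \<and> G (Vp r) = k - F r"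
    and Vm: "\<And>r. r \<in> {xm<..<xp} \<Longrightarrow> Vm r \<in> B \<and> Vm r \<le> 0 \<and> G (Vm r) = k - F r"
    and T: "T = (LBINT r=ereal xm..ereal xp. 1 / h (Vp r) - 1 / h (Vm r))"
  obtains x v where "0 < T" "traj UNIV x v" "\<forall>t. x (t + T) = x t" "x 0 = xm"
    "\<forall>t\<in>{0<..<T}. xm < x t" "\<not> x constant_on UNIV"
    "\<forall>c\<in>A. \<forall>d\<in>B. F c + G d = k \<longrightarrow> (\<exists>s. x s = c \<and> v s = d)"
proof -
  \<comment> \<open>Reversing time and momentum turns the way back into a half orbit of the reflected system.\<close>
  interpret R: oscillator A f F "uminus ` B" "\<lambda>s. - h (- s)" "\<lambda>s. G (- s)"
    using A.potential_axioms B.reflection by (rule oscillator.intro)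
  obtain x1 v1 L1 where o1: "0 < L1" "continuous_on {0..L1} x1" "continuous_on {0..L1} v1"
    "x1 0 = xm" "x1 L1 = xp" "v1 0 = 0" "v1 L1 = 0"
    "\<forall>t\<in>{0..L1}. x1 t \<in> {xm..xp} \<and> v1 t \<in> B \<and> 0 \<le> v1 t \<and> F (x1 t) + G (v1 t) = k"
    "\<forall>t\<in>{0<..<L1}. x1 t \<in> {xm<..<xp} \<and> (x1 has_real_derivative h (v1 t)) (at t)
      \<and> (v1 has_real_derivative - f (x1 t)) (at t)"
    "interval_lebesgue_integrable lborel (ereal xm) (ereal xp) (\<lambda>r. 1 / h (Vp r))"
    "(LBINT r=ereal xm..ereal xp. 1 / h (Vp r)) = L1"
    by (rule half_orbit[OF xm xp Vp])
  have Vm': "- Vm r \<in> uminus ` B \<and> 0 \<le> - Vm r \<and> G (- (- Vm r)) = k - F r"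
    if "r \<in> {xm<..<xp}" for r using Vm[OF that] by auto
  obtain x2 v2 L2 where o2: "0 < L2" "continuous_on {0..L2} x2" "continuous_on {0..L2} v2"
    "x2 0 = xm" "x2 L2 = xp" "v2 0 = 0" "v2 L2 = 0"
    "\<forall>t\<in>{0..L2}. x2 t \<in> {xm..xp} \<and> v2 t \<in> uminus ` B \<and> 0 \<le> v2 t \<and> F (x2 t) + G (- v2 t) = k"
    "\<forall>t\<in>{0<..<L2}. x2 t \<in> {xm<..<xp} \<and> (x2 has_real_derivative - h (- v2 t)) (at t)
      \<and> (v2 has_real_derivative - f (x2 t)) (at t)"
    "interval_lebesgue_integrable lborel (ereal xm) (ereal xp) (\<lambda>r. 1 / - h (- (- Vm r)))"
    "(LBINT r=ereal xm..ereal xp. 1 / - h (- (- Vm r))) = L2"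
    by (rule R.half_orbit[OF xm xp Vm'])
  have TL: "T = L1 + L2"
  proof -
    have "T = (LBINT r=ereal xm..ereal xp. 1 / h (Vp r) + 1 / - h (- (- Vm r)))"
      unfolding T by simp
    also have "\<dots> = L1 + L2"
      using interval_lebesgue_integral_add(2)[OF o1(10) o2(10)] o1(11) o2(11) by simp
    finally show ?thesis .
  qed
  have Tpos: "0 < T" using o1 o2 TL by simp
  define p where "p t = (if t \<le> L1 then x1 t else x2 (T - t))" for t
  define q where "q t = (if t \<le> L1 then v1 t else - v2 (T - t))" for t
  have contp: "continuous_on {0..T} p"
    unfolding p_def
    by (intro continuous_on_concat continuous_on_compose2[OF o2(2)] continuous_intros)
      (use o1(1-7) o2(1-7) TL in auto)
  have contq: "continuous_on {0..T} q"
    unfolding q_def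
    by (intro continuous_on_concat continuous_on_minus continuous_on_compose2[OF o2(3)] continuous_intros)
      (use o1(1-7) o2(1-7) TL in auto)
  have per: "p 0 = p T" "q 0 = q T" using o1(1-7) o2(1-7) TL by (auto simp: p_def q_def)
  have "- v2 t \<in> B" if "t \<in> {0..L2}" for t
    using o2(8) that by force
  then have mem: "p t \<in> {xm..xp}" "q t \<in> B" if "t \<in> {0..T}" for t
    using o1(8) o2(8) that TL by (auto simp: p_def q_def)
  have pA: "p ` {0..T} \<subseteq> A" using A.between[OF xm(1) xp(1)] mem by fastforce
  have qB: "q ` {0..T} \<subseteq> B" using mem by auto
  have ode: "(p has_real_derivative h (q t)) (at t) \<and> (q has_real_derivative - f (p t)) (at t) \<and> xm < p t"
    if t: "t \<in> {0<..<T} - {L1}" for t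
  proof (cases "t < L1")
    case True
    then have "t \<in> {0<..<L1}" using t by auto
    from o1(9)[rule_format, OF this] True show ?thesis
      unfolding p_def q_def
      by (auto intro: has_field_derivative_transform_within_open[of _ _ _ "{..<L1}"])
  next
    case False
    then have "T - t \<in> {0<..<L2}" "L1 < t" using t TL by auto
    note d = o2(9)[rule_format, OF this(1)]
    have "((\<lambda>t. T - t) has_real_derivative - 1) (at t)"
      by (auto intro!: derivative_eq_intros)
    then have "((\<lambda>t. x2 (T - t)) has_real_derivative - h (- v2 (T - t)) * (- 1)) (at t)"
      "((\<lambda>t. v2 (T - t)) has_real_derivative - f (x2 (T - t)) * (- 1)) (at t)"
      using d by (blast intro: DERIV_chain2)+
    then have d2: "((\<lambda>t. x2 (T - t)) has_real_derivative h (- v2 (T - t))) (at t)"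
      "((\<lambda>t. - v2 (T - t)) has_real_derivative - f (x2 (T - t))) (at t)"
      using DERIV_minus[of "\<lambda>t. v2 (T - t)"] by auto
    show ?thesis
      using \<open>L1 < t\<close> d d2 unfolding p_def q_def
      by (auto intro: has_field_derivative_transform_within_open[of _ _ _ "{L1<..}"])
  qed
  define x where "x = periodisation T p"
  define v where "v = periodisation T q"
  have restrict: "x t = p t" "v t = q t" if "t \<in> {0..T}" for t
    using periodisation_shift[OF Tpos per(1), of t 0] periodisation_shift[OF Tpos per(2), of t 0] that
    by (auto simp: x_def v_def)
  have range: "x t \<in> p ` {0..T}" "v t \<in> q ` {0..T}" for t
    using floor_divide_bounds[OF Tpos, of t] unfolding x_def v_def periodisation_def by auto
  have "traj UNIV x v"
    unfolding trajectory_def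
  proof (intro ballI conjI)
    fix t
    show "x t \<in> A" "v t \<in> B" using range[of t] pA qB by auto
    show "(x has_real_derivative h (v t)) (at t)"
      unfolding x_def v_def
      by (rule periodisation_derivative[OF Tpos per contp contq continuous_on_subset[OF B.cont qB]
            finite.insertI[OF finite.emptyI, of L1]]) (use ode in blast)
    show "(v has_real_derivative - f (x t)) (at t)"
      unfolding x_def v_def
      by (rule periodisation_derivative[OF Tpos per(2,1) contq contp
            continuous_on_minus[OF continuous_on_subset[OF A.cont pA]]
            finite.insertI[OF finite.emptyI, of L1]]) (use ode in blast)
  qed
  moreover have "\<forall>t. x (t + T) = x t" using periodisation_periodic[OF Tpos] by (simp add: x_def)
  moreover have "x 0 = xm" using restrict[of 0] o1 Tpos by (simp add: p_def)
  moreover have above: "\<forall>t\<in>{0<..<T}. xm < x t"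
  proof
    fix t assume t: "t \<in> {0<..<T}"
    show "xm < x t"
      using ode[of t] restrict[of t] t o1(5) xm xp by (cases "t = L1") (auto simp: p_def)
  qed
  moreover have "xm < x (T / 2)" using above Tpos by auto
  then have "\<not> x constant_on UNIV"
    using \<open>x 0 = xm\<close> unfolding constant_on_def by (metis UNIV_I less_irrefl)
  moreover have "\<exists>s. x s = c \<and> v s = d" if c: "c \<in> A" and d: "d \<in> B" and cd: "F c + G d = k" for c d
  proof -
    have "F c \<le> k" using cd B.P_nonneg[OF d] by simp
    then have cI: "c \<in> {xm..xp}"
      using A.P_less_pos[of xp c] A.P_less_neg[of c xm] c xm xp by (auto simp: not_less[symmetric])
    show ?thesis
    proof (cases "0 \<le> d")
      case True
      obtain s where s: "s \<in> {0..L1}" "x1 s = c"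
        using IVT'[of x1 0 c L1] o1 cI by auto
      have "v1 s = d"
        using B.P_inj_pos[of "v1 s" d] bspec[OF o1(8) s(1)] s(2) True d cd by auto
      then show ?thesis using restrict[of s] s TL o2(1) by (auto simp: p_def q_def)
    next
      case False
      obtain s where s: "s \<in> {0..L2}" "x2 s = c"
        using IVT'[of x2 0 c L2] o2 cI by auto
      have "v2 s = - d"
        using R.B.P_inj_pos[of "v2 s" "- d"] bspec[OF o2(8) s(1)] s(2) False d cd by auto
      then show ?thesis
        using restrict[of "T - s"] s TL o1(1,5,7) o2(5,7) False
        by (cases "s = L2") (auto simp: p_def q_def)
    qed
  qed
  ultimately show thesis using that Tpos by blast
qed

section \<open>Trajectories through a given point\<close>

text \<open>A time shift of the closed orbit meets the initial condition. No smaller period is possible, as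
  the leftmost position is attained exactly once per turn.\<close>

lemma periodic_trajectory:
  assumes cd: "c \<in> A" "d \<in> B" "F c + G d = k"
    and xm: "xm \<in> A" "xm < 0" "F xm = k" and xp: "xp \<in> A" "0 < xp" "F xp = k"
    and Vp: "\<And>r. r \<in> {xm<..<xp} \<Longrightarrow> Vp r \<in> B \<and> 0 \<le> Vp r \<and> G (Vp r) = k - F r"
    and Vm: "\<And>r. r \<in> {xm<..<xp} \<Longrightarrow> Vm r \<in> B \<and> Vm r \<le> 0 \<and> G (Vm r) = k - F r"
  obtains x v where "traj UNIV x v" "x a = c" "v a = d"
    "smallest_period x (LBINT r=ereal xm..ereal xp. 1 / h (Vp r) - 1 / h (Vm r))"
proof -
  let ?T = "LBINT r=ereal xm..ereal xp. 1 / h (Vp r) - 1 / h (Vm r)"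
  obtain x v where o: "0 < ?T" "traj UNIV x v" "\<forall>t. x (t + ?T) = x t" "x 0 = xm"
    "\<forall>t\<in>{0<..<?T}. xm < x t" "\<not> x constant_on UNIV"
    "\<forall>c\<in>A. \<forall>d\<in>B. F c + G d = k \<longrightarrow> (\<exists>s. x s = c \<and> v s = d)"
    by (rule closed_orbit[OF xm xp Vp Vm refl])
  obtain s where s: "x s = c" "v s = d" using o(7) cd by blast
  define X where "X t = x (t + (s - a))" for t
  define W where "W t = v (t + (s - a))" for t
  have "traj UNIV X W"
    using o(2) unfolding trajectory_def X_def W_def by (auto simp: DERIV_shift[symmetric])
  moreover have "X a = c" "W a = d" using s by (auto simp: X_def W_def)
  moreover have "\<not> X constant_on UNIV"
  proof
    assume "X constant_on UNIV"
    then obtain y where "X t = y" for t by (auto simp: constant_on_def)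
    then have "x t = y" for t using spec[of "\<lambda>t. X t = y" "t - (s - a)"] by (simp add: X_def)
    then show False using o(6) by (auto simp: constant_on_def)
  qed
  moreover have "X (t + ?T) = X t" for t
    using o(3)[rule_format, of "t + (s - a)"] by (simp add: X_def algebra_simps)
  moreover have "\<not> (\<forall>t. X (t + p) = X t)" if p: "0 < p" "p < ?T" for p
  proof
    assume "\<forall>t. X (t + p) = X t"
    then have "X (a - s + p) = X (a - s)" by blast
    then have "x p = xm" using o(4) by (simp add: X_def algebra_simps)
    moreover have "xm < x p" using o(5) p by auto
    ultimately show False by simp
  qed
  ultimately show thesis using that[of X W] o(1) unfolding smallest_period_def by auto
qed

lemma momentum_levels:
  assumes sp: "sp \<in> B" "0 \<le> sp" "k \<le> G sp" and sm: "sm \<in> B" "sm \<le> 0" "k \<le> G sm"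
  obtains Vp Vm where "\<forall>r\<in>A. F r \<le> k \<longrightarrow> Vp r \<in> B \<and> 0 \<le> Vp r \<and> G (Vp r) = k - F r"
    "\<forall>r\<in>A. F r \<le> k \<longrightarrow> Vm r \<in> B \<and> Vm r \<le> 0 \<and> G (Vm r) = k - F r"
proof -
  have "\<forall>r\<in>A. F r \<le> k \<longrightarrow> (\<exists>y. y \<in> B \<and> 0 \<le> y \<and> G y = k - F r)"
    "\<forall>r\<in>A. F r \<le> k \<longrightarrow> (\<exists>y. y \<in> B \<and> y \<le> 0 \<and> G y = k - F r)"
    using B.level_nonneg[OF sp(1,2)] B.level_nonpos[OF sm(1,2)] A.P_nonneg sp(3) sm(3)
    by (smt (verit))+
  then show thesis using that by metis
qed

lemma below_level:
  assumes xm: "xm \<in> A" "xm \<le> 0" "F xm = k" and xp: "xp \<in> A" "0 \<le> xp" "F xp = k"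
    and r: "r \<in> {xm<..<xp}"
  shows "r \<in> A \<and> F r \<le> k"
proof
  show "r \<in> A" using A.between[OF xm(1) xp(1)] r by auto
  show "F r \<le> k"
    using A.P_less_pos[of r xp] A.P_less_neg[of xm r] r xm xp by (cases "r < 0") auto
qed

lemma rest_trajectory: "traj I (\<lambda>_. 0) (\<lambda>_. 0)"
  using A.zero_S B.zero_S A.p_0 B.p_0 by (simp add: trajectory_def)

lemma zero_energy:
  assumes "c \<in> A" "d \<in> B" "F c + G d = 0"
  shows "c = 0" "d = 0"
  using assms A.P_pos[of c] B.P_pos[of d] A.P_nonneg[of c] B.P_nonneg[of d] by (smt (verit))+

text \<open>The closed orbit of a modified system is followed for a short time. It may leave the domain of
  \<open>f\<close> later, when the level set of the energy is not closed.\<close>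

lemma local_trajectory:
  assumes cd: "c \<in> A" "d \<in> B" "F c + G d = k"
    and sp: "sp \<in> B" "0 \<le> sp" "k \<le> G sp" and sm: "sm \<in> B" "sm \<le> 0" "k \<le> G sm"
  obtains e x v where "0 < e" "traj (ball a e) x v" "x a = c" "v a = d"
proof (cases "k = 0")
  case True
  then show thesis
    using that[of 1 "\<lambda>_. 0" "\<lambda>_. 0"] zero_energy[OF cd(1,2)] cd(3) rest_trajectory by simp
next
  case False
  have kpos: "0 < k" using False A.P_nonneg[OF cd(1)] B.P_nonneg[OF cd(2)] cd(3) by simp
  have "min 0 c \<in> A" "max 0 c \<in> A" using A.zero_S cd by (auto simp: min_def max_def)
  then obtain d1 d2 where d1: "0 < d1" "ball (min 0 c) d1 \<subseteq> A" and d2: "0 < d2" "ball (max 0 c) d2 \<subseteq> A"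
    using A.open_S unfolding open_contains_ball by blast
  define \<alpha> where "\<alpha> = min 0 c - d1 / 2"
  define \<beta> where "\<beta> = max 0 c + d2 / 2"
  have "\<alpha> \<in> ball (min 0 c) d1" "\<beta> \<in> ball (max 0 c) d2"
    using d1 d2 by (auto simp: \<alpha>_def \<beta>_def dist_real_def)
  then have \<alpha>\<beta>: "\<alpha> \<in> A" "\<beta> \<in> A" using d1(2) d2(2) by blast+
  have ord: "\<alpha> < 0" "\<alpha> < c" "0 < \<beta>" "c < \<beta>" using d1 d2 by (auto simp: \<alpha>_def \<beta>_def)
  \<comment> \<open>On the whole line every energy level is reached, so the modified oscillator has a closed orbit
    through the initial point; until it leaves \<open>(\<alpha>, \<beta>)\<close> it is a trajectory of the original one.\<close>
  obtain f' F' where pot: "potential UNIV f' F'"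
    and agree: "\<forall>s\<in>{\<alpha>..\<beta>}. f' s = f s \<and> F' s = F s"
    using A.extends_to_line[of \<alpha> \<beta>] \<alpha>\<beta> ord by auto
  interpret E: oscillator UNIV f' F' B h G
    using pot B.potential_axioms by (rule oscillator.intro)
  have cd': "F' c + G d = k" using agree ord cd by auto
  obtain up um where u: "0 \<le> up" "k \<le> F' up" "um \<le> 0" "k \<le> F' um"
    using E.A.coercive_right E.A.coercive_left kpos by (metis less_imp_le)
  obtain xp where xp: "0 \<le> xp" "F' xp = k"
    using E.A.level_nonneg[of up k] u kpos by auto
  obtain xm where xm: "xm \<le> 0" "F' xm = k"
    using E.A.level_nonpos[of um k] u kpos by auto
  have "xp \<noteq> 0" "xm \<noteq> 0" using xp xm kpos E.A.P_0 by auto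
  then have sgn: "0 < xp" "xm < 0" using xp xm by auto
  obtain Vp Vm where V: "\<forall>r\<in>UNIV. F' r \<le> k \<longrightarrow> Vp r \<in> B \<and> 0 \<le> Vp r \<and> G (Vp r) = k - F' r"
    "\<forall>r\<in>UNIV. F' r \<le> k \<longrightarrow> Vm r \<in> B \<and> Vm r \<le> 0 \<and> G (Vm r) = k - F' r"
    by (rule E.momentum_levels[OF sp sm])
  have below: "F' r \<le> k" if "r \<in> {xm<..<xp}" for r using E.below_level[of xm k xp r] xm xp that by simp
  have V': "Vp r \<in> B \<and> 0 \<le> Vp r \<and> G (Vp r) = k - F' r"
    "Vm r \<in> B \<and> Vm r \<le> 0 \<and> G (Vm r) = k - F' r" if "r \<in> {xm<..<xp}" for r
    using V below[OF that] by blast+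
  obtain x v where xv: "E.traj UNIV x v" "x a = c" "v a = d"
    and "smallest_period x (LBINT r=ereal xm..ereal xp. 1 / h (Vp r) - 1 / h (Vm r))"
    by (rule E.periodic_trajectory[OF UNIV_I cd(2) cd' UNIV_I sgn(2) xm(2) UNIV_I sgn(1) xp(2) V'])
  have "open (UNIV \<inter> x -` {\<alpha><..<\<beta>})"
    using trajectory_continuous[OF xv(1)] by (intro continuous_open_preimage) auto
  moreover have "a \<in> UNIV \<inter> x -` {\<alpha><..<\<beta>}" using xv ord by auto
  ultimately obtain e where e: "0 < e" "ball a e \<subseteq> UNIV \<inter> x -` {\<alpha><..<\<beta>}"
    unfolding open_contains_ball by blast
  have "traj (ball a e) x v"
    unfolding trajectory_def
  proof
    fix t assume "t \<in> ball a e"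
    then have "x t \<in> {\<alpha>..\<beta>}" using e by fastforce
    then have "x t \<in> A" "f' (x t) = f (x t)" using A.between[OF \<alpha>\<beta>] agree by auto
    then show "x t \<in> A \<and> v t \<in> B \<and> (x has_real_derivative h (v t)) (at t) \<and>
        (v has_real_derivative - f (x t)) (at t)"
      using bspec[OF xv(1)[unfolded trajectory_def] UNIV_I, of t] by simp
  qed
  then show thesis using that e xv by blast
qed

end

section \<open>Solutions of the second-order problem\<close>

lemma solution_imp_trajectory:
  assumes f: "continuous_on (einterval \<tau>1 \<tau>2) f" and g: "bij_betw g (einterval \<tau>3 \<tau>4) B"
    and sol: "is_solution f g \<tau>1 \<tau>2 \<tau>3 \<tau>4 a c1 c2 I y"
  shows "trajectory (einterval \<tau>1 \<tau>2) f B (the_inv_into (einterval \<tau>3 \<tau>4) g) I y (g \<circ> deriv y)"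
proof -
  note sol = sol[unfolded is_solution_def]
  have I: "open I" "is_interval I" using sol by auto
  have dy: "(y has_real_derivative deriv y t) (at t)" if "t \<in> I" for t
    using sol that unfolding C1_differentiable_on_def
    by (metis DERIV_imp_deriv has_real_derivative_iff_has_vector_derivative)
  have mem: "y t \<in> einterval \<tau>1 \<tau>2" "deriv y t \<in> einterval \<tau>3 \<tau>4" if "t \<in> I" for t
    using sol that by auto
  have "continuous_on I y" using dy DERIV_isCont by (metis continuous_at_imp_continuous_on)
  then have fy: "continuous_on I (\<lambda>t. - f (y t))"
    using mem by (intro continuous_on_minus continuous_on_compose2[OF f]) auto
  have "AE t in lborel. t \<in> I \<longrightarrow> ((g \<circ> deriv y) has_real_derivative - f (y t)) (at t)"
  proof -
    have "AE t in lborel. t \<in> I \<longrightarrow>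
        (\<exists>d. ((g \<circ> deriv y) has_real_derivative d) (at t) \<and> d + f (y t) = 0)"
      using sol by blast
    then show ?thesis by (rule AE_mp) (auto simp: add_eq_0_iff2)
  qed
  then have dv: "((g \<circ> deriv y) has_real_derivative - f (y t)) (at t)" if "t \<in> I" for t
    using sol by (intro abs_continuous_ode_classical[OF I fy _ _ that]) auto
  show ?thesis
    unfolding trajectory_def
  proof (intro ballI conjI)
    fix t assume t: "t \<in> I"
    show "y t \<in> einterval \<tau>1 \<tau>2" using mem t by auto
    show "(g \<circ> deriv y) t \<in> B" using mem[OF t] g by (auto simp: bij_betw_def)
    show "(y has_real_derivative the_inv_into (einterval \<tau>3 \<tau>4) g ((g \<circ> deriv y) t)) (at t)"
      using dy[OF t] the_inv_into_f_f[OF bij_betw_imp_inj_on[OF g] mem(2)[OF t]] by simp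
    show "((g \<circ> deriv y) has_real_derivative - f (y t)) (at t)" using dv[OF t] .
  qed
qed

lemma trajectory_imp_solution:
  assumes f: "continuous_on (einterval \<tau>1 \<tau>2) f" and g: "bij_betw g (einterval \<tau>3 \<tau>4) B"
    and h: "h = the_inv_into (einterval \<tau>3 \<tau>4) g" "continuous_on B h"
    and tr: "trajectory (einterval \<tau>1 \<tau>2) f B h I x v"
    and I: "open I" "is_interval I" "a \<in> I"
    and init: "x a = c1" "v a = g c2" "c2 \<in> einterval \<tau>3 \<tau>4"
  shows "is_solution f g \<tau>1 \<tau>2 \<tau>3 \<tau>4 a c1 c2 I x"
proof -
  have inj: "inj_on g (einterval \<tau>3 \<tau>4)" and img: "g ` einterval \<tau>3 \<tau>4 = B"
    using g by (auto simp: bij_betw_def)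
  have T: "x t \<in> einterval \<tau>1 \<tau>2" "v t \<in> B" "(x has_real_derivative h (v t)) (at t)"
    "(v has_real_derivative - f (x t)) (at t)" if "t \<in> I" for t
    using tr that by (auto simp: trajectory_def)
  have gh: "h s \<in> einterval \<tau>3 \<tau>4" "g (h s) = s" if "s \<in> B" for s
    using the_inv_into_into[OF inj, of s] f_the_inv_into_f[OF inj, of s] that img by (auto simp: h(1))
  have dx: "deriv x t = h (v t)" if "t \<in> I" for t using T(3)[OF that] by (rule DERIV_imp_deriv)
  have gd: "(g \<circ> deriv x) t = v t" if "t \<in> I" for t using gh(2)[OF T(2)] dx that by simp
  have cont: "continuous_on I x" "continuous_on I v" using trajectory_continuous[OF tr] by auto
  have "x C1_differentiable_on I"
    unfolding C1_differentiable_on_def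
  proof (intro exI[of _ "\<lambda>t. h (v t)"] conjI ballI)
    show "continuous_on I (\<lambda>t. h (v t))"
      by (rule continuous_on_compose2[OF h(2) cont(2)]) (use T in auto)
  qed (use T in \<open>auto simp: has_real_derivative_iff_has_vector_derivative[symmetric]\<close>)
  moreover have "abs_continuous_on {u..w} (g \<circ> deriv x)" if uw: "{u..w} \<subseteq> I" for u w
  proof -
    have c: "continuous_on {u..w} (\<lambda>t. - f (x t))"
      by (intro continuous_on_minus continuous_on_compose2[OF f] continuous_on_subset[OF cont(1) uw])
        (use T uw in auto)
    have d: "(v has_real_derivative - f (x t)) (at t within {u..w})" if "t \<in> {u..w}" for t
      by (rule has_field_derivative_at_within[OF T(4)]) (use uw that in blast)
    obtain C where "\<forall>s\<in>{u..w}. \<forall>t\<in>{u..w}. \<bar>v s - v t\<bar> \<le> C * \<bar>s - t\<bar>"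
      by (rule Lipschitz_of_continuous_derivative[OF c d])
    then show ?thesis
      by (intro abs_continuous_on_Lipschitz[of _ _ C]) (use gd uw in \<open>simp add: subset_iff\<close>)
  qed
  moreover have "((g \<circ> deriv x) has_real_derivative - f (x t)) (at t)" if "t \<in> I" for t
    by (rule has_field_derivative_transform_within_open[OF T(4)[OF that] I(1) that]) (simp only: gd)
  then have "AE t in lborel. t \<in> I \<longrightarrow>
      (\<exists>d. ((g \<circ> deriv x) has_real_derivative d) (at t) \<and> d + f (x t) = 0)"
    by (intro AE_I2) force
  moreover have "deriv x a = c2"
    using dx[OF I(3)] init the_inv_into_f_f[OF inj] by (simp add: h(1))
  moreover have "\<forall>t\<in>I. x t \<in> einterval \<tau>1 \<tau>2 \<and> deriv x t \<in> einterval \<tau>3 \<tau>4"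
    using T dx gh by auto
  ultimately show ?thesis using I init unfolding is_solution_def by blast
qed

theorem theorem2p2:
  fixes \<tau>1 \<tau>2 \<tau>3 \<tau>4 \<sigma>1 \<sigma>2 \<sigma>3 \<sigma>4 :: ereal
    and f g ginv F G :: "real \<Rightarrow> real"
    and a c1 c2 k T :: real
  assumes "\<tau>1 < \<tau>2" and "\<sigma>1 < \<sigma>2" and "\<tau>3 < \<tau>4" and "\<sigma>3 < \<sigma>4"
    and "bij_betw f (einterval \<tau>1 \<tau>2) (einterval \<sigma>1 \<sigma>2)"
    and "bij_betw g (einterval \<tau>3 \<tau>4) (einterval \<sigma>3 \<sigma>4)"
    and "ginv = the_inv_into (einterval \<tau>3 \<tau>4) g"
    and "continuous_on (einterval \<tau>1 \<tau>2) f"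
    and "continuous_on (einterval \<sigma>3 \<sigma>4) ginv"
    and "0 \<in> einterval \<tau>1 \<tau>2 \<inter> einterval \<tau>3 \<tau>4"
    and "f 0 = 0" and "g 0 = 0"
    and "strict_mono_on (einterval \<tau>1 \<tau>2) f"
    and "strict_mono_on (einterval \<tau>3 \<tau>4) g"
    and "F = primitive f" and "G = primitive ginv"
    and "c1 \<in> einterval \<tau>1 \<tau>2" and "c2 \<in> einterval \<tau>3 \<tau>4"
    and "ereal (F c1 + G (g c2)) < min (limit_right G \<sigma>3) (limit_left G \<sigma>4)"
    and "k = G (g c2) + F c1"
    and "T = (LBINT r=ereal (inv_minus \<tau>1 F k)..ereal (inv_plus \<tau>2 F k).
                1 / ginv (inv_plus \<sigma>4 G (k - F r)) - 1 / ginv (inv_minus \<sigma>3 G (k - F r)))"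
  shows "\<exists>I x. is_solution f g \<tau>1 \<tau>2 \<tau>3 \<tau>4 a c1 c2 I x \<and>
           (\<forall>y. is_solution f g \<tau>1 \<tau>2 \<tau>3 \<tau>4 a c1 c2 I y \<longrightarrow> (\<forall>t\<in>I. y t = x t)) \<and>
           (ereal (F c1 + G (g c2)) < min (limit_right F \<tau>1) (limit_left F \<tau>2) \<longrightarrow>
              (\<exists>X. is_solution f g \<tau>1 \<tau>2 \<tau>3 \<tau>4 a c1 c2 UNIV X \<and> (\<forall>t\<in>I. X t = x t) \<and>
                   smallest_period X T))"
proof -
  let ?A = "einterval \<tau>1 \<tau>2" and ?B = "einterval \<sigma>3 \<sigma>4" and ?E = "einterval \<tau>3 \<tau>4"
  note bij = assms(6) and ginv = assms(7) and contf = assms(8) and contg = assms(9)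
  note monog = assms(14) and k = assms(20) and T = assms(21)
  have inj: "inj_on g ?E" and img: "g ` ?E = ?B" using bij by (auto simp: bij_betw_def)
  have gc2: "g c2 \<in> ?B" using img assms(18) by blast
  have "strict_mono_on ?B ginv"
  proof (rule strict_mono_onI)
    fix r s assume rs: "r \<in> ?B" "s \<in> ?B" "r < s"
    have in_E: "ginv y \<in> ?E" and g_ginv: "g (ginv y) = y" if "y \<in> ?B" for y
      using the_inv_into_into[OF inj, of y ?E] f_the_inv_into_f[OF inj, of y] that img
      by (auto simp: ginv)
    show "ginv r < ginv s"
    proof (rule ccontr)
      assume "\<not> ginv r < ginv s"
      then have "s \<le> r"
        using strict_mono_on_leD[OF monog in_E[OF rs(2)] in_E[OF rs(1)]] g_ginv rs by simp
      then show False using rs by simp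
    qed
  qed
  moreover have "ginv 0 = 0" "0 \<in> ?B"
    using the_inv_into_f_f[OF inj, of 0] assms(10,12) img by (auto simp: ginv)
  ultimately interpret O: oscillator ?A f F ?B ginv G
    unfolding assms(15,16) using assms by (intro oscillator.intro potential_primitive) auto
  have energy: "F c1 + G (g c2) = k" by (simp add: k)
  have k0: "0 \<le> k" using energy O.A.P_nonneg[OF assms(17)] O.B.P_nonneg[OF gc2] by simp
  obtain sp where sp: "sp \<in> ?B" "0 \<le> sp" "k \<le> G sp"
    using O.B.below_limit_left[OF refl] assms(19) energy by auto
  obtain sm where sm: "sm \<in> ?B" "sm \<le> 0" "k \<le> G sm"
    using O.B.below_limit_right[OF refl] assms(19) energy by auto
  obtain e x v where loc: "0 < e" "O.traj (ball a e) x v" "x a = c1" "v a = g c2"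
    by (rule O.local_trajectory[OF assms(17) gc2 energy sp sm])
  have I: "open (ball a e)" "is_interval (ball a e)" "a \<in> ball a e"
    using loc by (auto simp: is_interval_ball_real)
  have sol: "is_solution f g \<tau>1 \<tau>2 \<tau>3 \<tau>4 a c1 c2 (ball a e) x"
    by (rule trajectory_imp_solution[OF contf bij ginv contg loc(2) I loc(3,4) assms(18)])
  moreover have "\<forall>t\<in>ball a e. y t = x t" if y: "is_solution f g \<tau>1 \<tau>2 \<tau>3 \<tau>4 a c1 c2 (ball a e) y" for y
  proof
    fix t assume t: "t \<in> ball a e"
    have "O.traj (ball a e) y (g \<circ> deriv y)"
      using solution_imp_trajectory[OF contf bij y] by (simp add: ginv)
    moreover have "y a = c1" "deriv y a = c2" using y by (auto simp: is_solution_def)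
    ultimately show "y t = x t"
      using O.unique_trajectory[OF _ loc(2) I, of y "g \<circ> deriv y" t] loc t by simp
  qed
  moreover have "\<exists>X. is_solution f g \<tau>1 \<tau>2 \<tau>3 \<tau>4 a c1 c2 UNIV X \<and> (\<forall>t\<in>ball a e. X t = x t) \<and>
      smallest_period X T" if lim: "ereal (F c1 + G (g c2)) < min (limit_right F \<tau>1) (limit_left F \<tau>2)"
  proof -
    define xp where "xp = inv_plus \<tau>2 F k"
    define xm where "xm = inv_minus \<tau>1 F k"
    obtain up where "up \<in> ?A" "0 \<le> up" "k \<le> F up"
      using O.A.below_limit_left[OF refl] lim energy by auto
    from O.A.inv_plus[OF refl this(1,2) k0 this(3)]
    have xp: "xp \<in> ?A" "0 \<le> xp" "F xp = k" by (auto simp: xp_def)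
    obtain um where "um \<in> ?A" "um \<le> 0" "k \<le> F um"
      using O.A.below_limit_right[OF refl] lim energy by auto
    from O.A.inv_minus[OF refl this(1,2) k0 this(3)]
    have xm: "xm \<in> ?A" "xm \<le> 0" "F xm = k" by (auto simp: xm_def)
    have "\<exists>X W. O.traj UNIV X W \<and> X a = c1 \<and> W a = g c2 \<and> smallest_period X T"
    \<comment> \<open>At energy zero the orbit is the equilibrium, and the period integral runs over a single point.\<close>
    proof (cases "k = 0")
      case True
      have "xp = 0" "xm = 0" using O.A.P_pos xp xm True by force+
      then have "T = 0" unfolding T by (simp add: xp_def[symmetric] xm_def[symmetric])
      then have "smallest_period (\<lambda>_. 0) T" by (auto simp: smallest_period_def constant_on_def)
      then show ?thesis
        using O.rest_trajectory O.zero_energy[OF assms(17) gc2] energy True by metis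
    next
      case False
      have "xp \<noteq> 0" "xm \<noteq> 0" using False xp xm O.A.P_0 by auto
      then have sgn: "0 < xp" "xm < 0" using xp xm by auto
      have lev: "0 \<le> k - F r" "k - F r \<le> k" if "r \<in> {xm<..<xp}" for r
        using O.below_level[OF xm xp that] O.A.P_nonneg[of r] by auto
      obtain X W where "O.traj UNIV X W" "X a = c1" "W a = g c2"
        "smallest_period X (LBINT r=ereal xm..ereal xp.
            1 / ginv (inv_plus \<sigma>4 G (k - F r)) - 1 / ginv (inv_minus \<sigma>3 G (k - F r)))"
      proof (rule O.periodic_trajectory[OF assms(17) gc2 energy xm(1) sgn(2) xm(3) xp(1) sgn(1) xp(3)])
        fix r assume r: "r \<in> {xm<..<xp}"
        show "inv_plus \<sigma>4 G (k - F r) \<in> ?B \<and> 0 \<le> inv_plus \<sigma>4 G (k - F r) \<and>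
            G (inv_plus \<sigma>4 G (k - F r)) = k - F r"
          by (rule O.B.inv_plus[OF refl sp(1,2) lev(1)[OF r] order_trans[OF lev(2)[OF r] sp(3)]])
        show "inv_minus \<sigma>3 G (k - F r) \<in> ?B \<and> inv_minus \<sigma>3 G (k - F r) \<le> 0 \<and>
            G (inv_minus \<sigma>3 G (k - F r)) = k - F r"
          by (rule O.B.inv_minus[OF refl sm(1,2) lev(1)[OF r] order_trans[OF lev(2)[OF r] sm(3)]])
      qed
      then show ?thesis unfolding T xp_def xm_def by blast
    qed
    then obtain X W where X: "O.traj UNIV X W" "X a = c1" "W a = g c2" "smallest_period X T" by blast
    have "is_solution f g \<tau>1 \<tau>2 \<tau>3 \<tau>4 a c1 c2 UNIV X"
      by (rule trajectory_imp_solution[OF contf bij ginv contg X(1) _ _ _ X(2,3) assms(18)]) auto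
    moreover have "O.traj (ball a e) X W" using X(1) by (simp add: trajectory_def)
    then have "\<forall>t\<in>ball a e. X t = x t"
      using O.unique_trajectory[OF _ loc(2) I] X loc by auto
    ultimately show ?thesis using X(4) by blast
  qed
  ultimately show ?thesis by blast
qed

end
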